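(* For any $c\in \mathbb{C}$ and $\alpha\in \mathfrak h[[h]]$ there exists a unique structure of restricted $\mathrm{H}(C)$-module of level $c$ on $\mathcal V_{\mathrm{H}}(c)$ such that for all $n\geqslant 0$ we have $$y_0(u_0)\, \mathrm{diag} \big(x_{[n]}^+ (u)\big)=\mathrm{diag} \Big( \left(x_0(u_0)+u_0^{-1} a_0 (\alpha) \right) x_{[n]}^+ (u)\Big),$$ where $u=(u_1,\ldots ,u_n)$ is a family of variables and $a(\alpha)=\sum_{i=1}^N \langle a_i,\alpha\rangle\, e_{ii}$ is the diagonal matrix, applied (as indicated by the subscript $0$) on the first tensor factor of $\mathrm{End}\,\mathbb C^N \otimes(\mathrm{End}\,\mathbb C^N)^{\otimes n}\otimes \mathcal V_{\mathrm{H}}(c)$.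
   Context: **Conventions.** $N\geqslant 2$ is an integer, $h$ a formal parameter. A $\mathbb C[[h]]$-module is topologically free if it is torsion-free, separated and $h$-adically complete (equivalently $\cong V_0[[h]]$). $\mathrm{Hom}$ means $\mathbb C[[h]]$-module maps. For a $\mathbb C[[h]]$-module $V$, $V((u))_h$ is the module of series $\sum_{r\in\mathbb Z}a_ru^{-r-1}\in V[[u^{\pm1}]]$ with $a_r\to0$ $h$-adically as $r\to\infty$, and $V[u^{-1}]_h$ the submodule of those in $V[[u^{-1}]]$. Expressions $(x_1+\dots+x_n)^r$ with $r<0$ are expanded in nonnegative powers of $x_2,\dots,x_n$. Subscripts indicate the tensor factors on which operators act; the factors $\mathrm{End}\,\mathbb C^N\otimes(\mathrm{End}\,\mathbb C^N)^{\otimes n}$ are labelled $0,1,\dots,n$. $\mathrm{diag}$ keeps only the terms whose matrix part is a tensor product of diagonal matrix units $e_{i_1i_1}\otimes e_{i_2i_2}\otimes\cdots$ (in all matrix factors). **The series $S$.** Let $R(u)=I-\frac hu P$ on $\mathbb C^N\otimes\mathbb C^N$, $I$ the identity, $P=\sum_{i,j}e_{ij}\otimes e_{ji}$. There is a unique series $G(u,C)=1+\frac{C+N}{N}\frac{h^2}{u^2}-\dots\in\mathbb C[C][[h/u]]$ with $\mathrm{tr}_1(G(u,C)R(u)R(-u-hC)-I)=\mathrm{tr}_2(G(u,C)R(u)R(-u-hC)-I)=0$. Put $S(u,C)=h^{-2}(G(u,C)R(u)R(-u-hC)-I)$, $S(u)=S(u,c)$ for $c\in\mathbb C$, and let $s_{ij}(u,C)\in\mathbb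 C[C,u^{-1}][[h]]$ be the coefficient of $e_{ii}\otimes e_{jj}$ in $S(u,C)$. **The algebra $\mathrm{H}(C)$** is the $h$-adically complete associative $\mathbb C[[h]]$-algebra generated by a central element $C$ and $y_i^{(r)}$, $i=1,\dots,N$, $r\in\mathbb Z$, subject to, with $y^i(u)=\sum_{r\in\mathbb Z}y_i^{(r)}u^{-r-1}$, $y^i(u)y^j(v)+s_{ij}(u-v,C)=y^j(v)y^i(u)+s_{ij}(v-u,C)$ for all $i,j$ and $y^1(u)+\dots+y^N(u)=0$. Put $y(u)=\sum_ie_{ii}\otimes y^i(u)$. An $\mathrm{H}(C)$-module $W$ has level $c$ if $C$ acts as the scalar $c$; it is restricted if $W$ is a topologically free $\mathbb C[[h]]$-module and $y^i(z)\in\mathrm{Hom}(W,W((z))_h)$ for all $i$. **$\mathcal V_{\mathrm{H}}(c)$ and operators.** $\mathrm{H}^+_N$ is the quotient of $\mathbb C[x_{ij}^{(-r)}: i,j=1,\dots,N,\ r\geqslant1][[h]]$ by the $h$-adically complete ideal generated by $x_{11}^{(-r)}+\dots+x_{NN}^{(-r)}$, $r\geqslant1$; $\mathbf 1$ is its unit. Put $x^+_{ij}(u)=\sum_{r\geqslant1}x_{ij}^{(-r)}u^{r-1}$, $x^+(u)=\sum_{i,j}e_{ij}\otimes x^+_{ij}(u)$, $x^+_{[n]}(u)=x^+_1(u_1)\cdots x^+_n(u_n)$ ($x_k^+$ has its matrix part in the $k$-th matrix factor), $x^+_{[0]}=\mathbf 1$. $x^-(u)=\sum_{i,j}e_{ij}\otimes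 x^-_{ij}(u)$, $x^-_{ij}(u)=\sum_{r\geqslant1}x_{ij}^{(r-1)}u^{-r}$, is the unique element of $\mathrm{End}\,\mathbb C^N\otimes\mathrm{Hom}(\mathrm{H}^+_N,\mathrm{H}^+_N[u^{-1}]_h)$ with $x^-(u)\mathbf 1=0$ and $x^-_0(u_0)x^+_{[n]}(u)=-\sum_{j=1}^nS_{0j}(u_0-u_j)x_1^+(u_1)\cdots x_{j-1}^+(u_{j-1})x_{j+1}^+(u_{j+1})\cdots x_n^+(u_n)$ for all $n\geqslant1$. Put $x(u)=x^+(u)+x^-(u)$, with $x^+(u)$ acting by multiplication. $\mathcal V_{\mathrm{H}}(c)\subset\mathrm{H}^+_N$ is the topologically free subalgebra generated by $\mathbf 1$ and all $x_{ii}^{(-r)}$, $i=1,\dots,N$, $r\geqslant1$; it is the quotient of $\mathbb C[x_{ii}^{(-r)}:i=1,\dots,N,\ r\geqslant1][[h]]$ by the $h$-adically complete ideal generated by the $x_{11}^{(-r)}+\dots+x_{NN}^{(-r)}$. **$\mathfrak h$.** $\mathfrak h$ is the complex space (abelian Lie algebra) with generators $a_1,\dots,a_N$ and relation $a_1+\dots+a_N=0$, with symmetric bilinear form $\langle a_i,a_j\rangle=\delta_{ij}-\frac1N$, extended $\mathbb C[[h]]$-bilinearly to $\mathfrak h[[h]]$. *)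

theory Defs
  imports
    "HOL-Analysis.Finite_Cartesian_Product"
    "HOL-Computational_Algebra.Polynomial"
    "HOL-Computational_Algebra.Formal_Power_Series"
    "HOL-Library.Poly_Mapping"
    "HOL-Library.FuncSet"
begin

unbundle no fps_syntax

text \<open>
  The ground ring \<open>\<complex>[[h]]\<close> is \<^typ>\<open>complex fps\<close>, with \<^term>\<open>fps_X\<close> in the role of \<open>h\<close>.  The index
  set \<open>{1, \<dots>, N}\<close> is a finite type \<open>'n\<close>, so \<open>N = CARD('n)\<close>.
\<close>


section \<open>Modules over the ring of formal power series in h\<close>

text \<open>
  A module is a subset \<open>W\<close> of an abelian group type, together with a scalar multiplication \<open>s\<close>.
\<close>

definition h_pow :: "(complex fps \<Rightarrow> 'w \<Rightarrow> 'w) \<Rightarrow> 'w set \<Rightarrow> nat \<Rightarrow> 'w set" where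
  "h_pow s W m = s (fps_X ^ m) ` W"

definition torsion_free :: "(complex fps \<Rightarrow> 'w::ab_group_add \<Rightarrow> 'w) \<Rightarrow> 'w set \<Rightarrow> bool" where
  "torsion_free s W \<longleftrightarrow> (\<forall>f. \<forall>w\<in>W. s f w = 0 \<longrightarrow> f = 0 \<or> w = 0)"

definition h_separated :: "(complex fps \<Rightarrow> 'w::ab_group_add \<Rightarrow> 'w) \<Rightarrow> 'w set \<Rightarrow> bool" where
  "h_separated s W \<longleftrightarrow> (\<Inter>m. h_pow s W m) = {0}"

definition h_complete :: "(complex fps \<Rightarrow> 'w::ab_group_add \<Rightarrow> 'w) \<Rightarrow> 'w set \<Rightarrow> bool" where
  "h_complete s W \<longleftrightarrow>
     (\<forall>w :: nat \<Rightarrow> 'w. range w \<subseteq> W \<longrightarrow>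
        (\<forall>m. \<exists>n0. \<forall>n\<ge>n0. \<forall>n'\<ge>n0. w n - w n' \<in> h_pow s W m) \<longrightarrow>
        (\<exists>l\<in>W. \<forall>m. \<exists>n0. \<forall>n\<ge>n0. w n - l \<in> h_pow s W m))"

definition topologically_free :: "(complex fps \<Rightarrow> 'w::ab_group_add \<Rightarrow> 'w) \<Rightarrow> 'w set \<Rightarrow> bool" where
  "topologically_free s W \<longleftrightarrow>
     module s \<and> module.subspace s W \<and> torsion_free s W \<and> h_separated s W \<and> h_complete s W"

text \<open>
  A formal series \<open>\<Sum>k\<in>\<int>. f\<^sub>k u\<^sup>k\<close> is the function \<open>k \<mapsto> f\<^sub>k\<close>.  Thus the coefficient \<open>a\<^sub>r\<close> of
  \<open>u\<^sup>-\<^sup>r\<^sup>-\<^sup>1\<close> is \<open>f (- r - 1)\<close>.  The next two sets are \<open>W((u))\<^sub>h\<close> and \<open>W[u\<^sup>-\<^sup>1]\<^sub>h\<close>.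
\<close>

definition laurent_h :: "(complex fps \<Rightarrow> 'w \<Rightarrow> 'w) \<Rightarrow> 'w set \<Rightarrow> (int \<Rightarrow> 'w) set" where
  "laurent_h s W =
     {f. range f \<subseteq> W \<and> (\<forall>m. \<exists>r0. \<forall>r\<ge>r0. f (- r - 1) \<in> h_pow s W m)}"

definition inv_poly_h :: "(complex fps \<Rightarrow> 'w::zero \<Rightarrow> 'w) \<Rightarrow> 'w set \<Rightarrow> (int \<Rightarrow> 'w) set" where
  "inv_poly_h s W = {f \<in> laurent_h s W. \<forall>k>0. f k = 0}"

definition series_Hom ::
  "(complex fps \<Rightarrow> 'w::plus \<Rightarrow> 'w) \<Rightarrow> 'w set \<Rightarrow> (int \<Rightarrow> 'w) set \<Rightarrow> ('w \<Rightarrow> int \<Rightarrow> 'w) set" where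
  "series_Hom s W F =
     {\<phi>. (\<forall>w\<in>W. \<phi> w \<in> F) \<and>
         (\<forall>v\<in>W. \<forall>w\<in>W. \<phi> (v + w) = (\<lambda>k. \<phi> v k + \<phi> w k)) \<and>
         (\<forall>f. \<forall>w\<in>W. \<phi> (s f w) = (\<lambda>k. s f (\<phi> w k)))}"


section \<open>Closed ideals\<close>

text \<open>The metric topology of \<^typ>\<open>'a fps\<close> is the \<open>h\<close>-adic topology of \<open>A[[h]]\<close>.\<close>

definition two_sided_ideal :: "'a::ring_1 set \<Rightarrow> bool" where
  "two_sided_ideal I \<longleftrightarrow>
     0 \<in> I \<and> (\<forall>x\<in>I. \<forall>y\<in>I. x + y \<in> I) \<and> (\<forall>a. \<forall>x\<in>I. a * x \<in> I \<and> x * a \<in> I)"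

definition closed_ideal :: "'a::ring_1 fps set \<Rightarrow> 'a fps set" where
  "closed_ideal X = \<Inter>{I. two_sided_ideal I \<and> closed I \<and> X \<subseteq> I}"

lemma two_sided_ideal_closed_ideal: "two_sided_ideal (closed_ideal X)"
  by (auto simp: two_sided_ideal_def closed_ideal_def)

lemma closed_ideal_0: "0 \<in> closed_ideal X"
  using two_sided_ideal_closed_ideal[of X] by (auto simp: two_sided_ideal_def)

lemma closed_ideal_add: "x \<in> closed_ideal X \<Longrightarrow> y \<in> closed_ideal X \<Longrightarrow> x + y \<in> closed_ideal X"
  using two_sided_ideal_closed_ideal[of X] by (auto simp: two_sided_ideal_def)

lemma closed_ideal_mult_left: "x \<in> closed_ideal X \<Longrightarrow> a * x \<in> closed_ideal X"
  using two_sided_ideal_closed_ideal[of X] by (auto simp: two_sided_ideal_def)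

lemma closed_ideal_mult_right: "x \<in> closed_ideal X \<Longrightarrow> x * a \<in> closed_ideal X"
  using two_sided_ideal_closed_ideal[of X] by (auto simp: two_sided_ideal_def)

lemma closed_ideal_uminus: "x \<in> closed_ideal X \<Longrightarrow> - x \<in> closed_ideal X"
  using closed_ideal_mult_left[of x X "-1"] by simp

lemma closed_ideal_cong_add:
  assumes "a - b \<in> closed_ideal X" "c - d \<in> closed_ideal X"
  shows "(a + c) - (b + d) \<in> closed_ideal X"
  using closed_ideal_add[OF assms] by (simp add: algebra_simps)

lemma closed_ideal_cong_uminus:
  assumes "a - b \<in> closed_ideal X"
  shows "(- a) - (- b) \<in> closed_ideal X"
  using closed_ideal_uminus[OF assms] by (simp add: algebra_simps)

lemma closed_ideal_cong_diff:
  assumes "a - b \<in> closed_ideal X" "c - d \<in> closed_ideal X"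
  shows "(a - c) - (b - d) \<in> closed_ideal X"
  using closed_ideal_add[OF assms(1) closed_ideal_uminus[OF assms(2)]] by (simp add: algebra_simps)

lemma closed_ideal_cong_mult:
  assumes "a - b \<in> closed_ideal X" "c - d \<in> closed_ideal X"
  shows "(a * c) - (b * d) \<in> closed_ideal X"
  using closed_ideal_add[OF closed_ideal_mult_right[OF assms(1), of c]
      closed_ideal_mult_left[OF assms(2), of b]]
  by (simp add: algebra_simps)

lemma equivp_closed_ideal: "equivp (\<lambda>a b. a - b \<in> closed_ideal X)"
proof (rule equivpI)
  show "reflp (\<lambda>a b. a - b \<in> closed_ideal X)"
    by (auto simp: reflp_def closed_ideal_0)
  show "symp (\<lambda>a b. a - b \<in> closed_ideal X)"
    using closed_ideal_uminus by (force simp: symp_def)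
  show "transp (\<lambda>a b. a - b \<in> closed_ideal X)"
    using closed_ideal_add by (fastforce simp: transp_def)
qed


section \<open>The series S\<close>

text \<open>
  Elements of \<open>End \<complex>\<^sup>N \<otimes> End \<complex>\<^sup>N\<close> are matrices indexed by pairs: the coefficient of
  \<open>e\<^sub>a\<^sub>b \<otimes> e\<^sub>d\<^sub>e\<close> in \<open>M\<close> is \<open>M $ (a, d) $ (b, e)\<close>.
\<close>

definition mat_unit :: "'n \<Rightarrow> 'n \<Rightarrow> 'a::zero_neq_one ^ 'n ^ 'n" where
  "mat_unit i j = (\<chi> a b. if a = i \<and> b = j then 1 else 0)"

definition mat_tensor ::
  "'a::times ^ 'n ^ 'n \<Rightarrow> 'a ^ 'n ^ 'n \<Rightarrow> 'a ^ ('n \<times> 'n) ^ ('n \<times> 'n)" where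
  "mat_tensor A B = (\<chi> p q. A $ fst p $ fst q * B $ snd p $ snd q)"

definition perm_P :: "'a::comm_ring_1 ^ ('n \<times> 'n) ^ ('n \<times> 'n::finite)" where
  "perm_P = (\<Sum>i\<in>UNIV. \<Sum>j\<in>UNIV. mat_tensor (mat_unit i j) (mat_unit j i))"

definition tr_1 :: "'a::comm_ring_1 ^ ('n \<times> 'n) ^ ('n \<times> 'n::finite) \<Rightarrow> 'a ^ 'n ^ 'n" where
  "tr_1 M = (\<chi> k l. \<Sum>i\<in>UNIV. M $ (i, k) $ (i, l))"

definition tr_2 :: "'a::comm_ring_1 ^ ('n \<times> 'n) ^ ('n \<times> 'n::finite) \<Rightarrow> 'a ^ 'n ^ 'n" where
  "tr_2 M = (\<chi> k l. \<Sum>i\<in>UNIV. M $ (k, i) $ (l, i))"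

text \<open>\<open>R\<close> as a function of the quotient \<open>q = h/u\<close>.\<close>

definition R_mat :: "'a::comm_ring_1 \<Rightarrow> 'a ^ ('n \<times> 'n) ^ ('n \<times> 'n::finite)" where
  "R_mat q = mat 1 - mat q ** perm_P"

text \<open>
  In \<^typ>\<open>complex poly fps\<close>, which stands for \<open>\<complex>[C][[h/u]]\<close>, the variable \<^term>\<open>fps_X\<close> is \<open>h/u\<close>
  and \<^term>\<open>[:0, 1:]\<close> is \<open>C\<close>.  Expanding in nonnegative powers of \<open>hC\<close>,
  \<open>h/(-u-hC) = - (h/u) \<Sum>k. (-C)\<^sup>k (h/u)\<^sup>k\<close>.
\<close>

definition h_over_shifted :: "complex poly fps" where
  "h_over_shifted = - fps_X * Abs_fps (\<lambda>k. (- [:0, 1:]) ^ k)"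

definition GRR_minus_I ::
  "complex poly fps \<Rightarrow> complex poly fps ^ ('n \<times> 'n) ^ ('n \<times> 'n::finite)" where
  "GRR_minus_I g = mat g ** R_mat fps_X ** R_mat h_over_shifted - mat 1"

definition G_ser :: "'n::finite itself \<Rightarrow> complex poly fps" where
  "G_ser _ = (THE g. tr_1 (GRR_minus_I g :: _ ^ ('n \<times> 'n) ^ ('n \<times> 'n)) = 0 \<and>
                     tr_2 (GRR_minus_I g :: _ ^ ('n \<times> 'n) ^ ('n \<times> 'n)) = 0)"

text \<open>
  The embedding of \<open>A[[h/u]]\<close> into \<open>A[u\<^sup>-\<^sup>1][[h]]\<close>; in \<^typ>\<open>'a poly fps\<close> the polynomial variable
  is \<open>u\<^sup>-\<^sup>1\<close> and the power series variable is \<open>h\<close>.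
\<close>

definition in_h_and_inv_u :: "'a::zero fps \<Rightarrow> 'a poly fps" where
  "in_h_and_inv_u f = Abs_fps (\<lambda>m. monom (fps_nth f m) m)"

text \<open>
  The shift by two is the division by \<open>h\<^sup>2\<close>; the terms of degrees 0 and 1 in \<open>h\<close> vanish.
\<close>

definition S_C :: "complex poly poly fps ^ ('n \<times> 'n) ^ ('n \<times> 'n::finite)" where
  "S_C = (\<chi> p q. fps_shift 2
            (in_h_and_inv_u (GRR_minus_I (G_ser TYPE('n)) $ p $ q)))"

definition s_C :: "'n::finite \<Rightarrow> 'n \<Rightarrow> complex poly poly fps" where
  "s_C i j = S_C $ (i, j) $ (i, j)"

definition S_at :: "complex \<Rightarrow> complex poly fps ^ ('n \<times> 'n) ^ ('n \<times> 'n::finite)" where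
  "S_at c = (\<chi> p q. Abs_fps (\<lambda>m. map_poly (\<lambda>a. poly a c) (fps_nth (S_C $ p $ q) m)))"

text \<open>
  \<^term>\<open>expand_diff f a b\<close> is the coefficient of \<open>u\<^sup>a v\<^sup>b\<close> in \<open>f(u - v)\<close>, expanded in nonnegative
  powers of \<open>v\<close>: \<open>(u - v)\<^sup>-\<^sup>r = \<Sum>b. (r + b - 1 choose b) u\<^sup>-\<^sup>r\<^sup>-\<^sup>b v\<^sup>b\<close>, so \<open>r = - a - b\<close> and
  \<open>r + b - 1 = - a - 1\<close>.  (For \<open>r = 0\<close> the binomial coefficient vanishes unless \<open>b = 0\<close>.)
\<close>

definition expand_diff :: "'a::comm_ring_1 poly fps \<Rightarrow> int \<Rightarrow> int \<Rightarrow> 'a fps" where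
  "expand_diff f a b = Abs_fps (\<lambda>m.
     if b \<ge> 0 \<and> a + b \<le> 0
     then coeff (fps_nth f m) (nat (- a - b)) *
          of_nat (nat (- a - 1) choose nat b)
     else 0)"


section \<open>The algebra H(C)\<close>

datatype 'g free_monoid = Word "'g list"

instantiation free_monoid :: (type) monoid_add
begin

definition zero_free_monoid :: "'a free_monoid" where
  "zero_free_monoid = Word []"

fun plus_free_monoid :: "'a free_monoid \<Rightarrow> 'a free_monoid \<Rightarrow> 'a free_monoid" where
  "plus_free_monoid (Word xs) (Word ys) = Word (xs @ ys)"

instance
proof
  fix a b c :: "'a free_monoid"
  show "a + b + c = a + (b + c)" by (cases a; cases b; cases c) simp
  show "0 + a = a" by (cases a) (simp add: zero_free_monoid_def)
  show "a + 0 = a" by (cases a) (simp add: zero_free_monoid_def)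
qed

end

datatype 'n H_gen = Gen_C | Gen_y 'n int

text \<open>
  The free associative \<open>\<complex>\<close>-algebra on the generators is the monoid algebra of the free monoid,
  and the \<open>h\<close>-adically complete free algebra consists of the power series over it.
\<close>

type_synonym 'n free_alg = "'n H_gen free_monoid \<Rightarrow>\<^sub>0 complex"

definition free_gen :: "'n H_gen \<Rightarrow> 'n free_alg" where
  "free_gen g = Poly_Mapping.single (Word [g]) 1"

definition free_C :: "'n free_alg fps" where
  "free_C = fps_const (free_gen Gen_C)"

definition free_y :: "'n \<Rightarrow> int \<Rightarrow> 'n free_alg fps" where
  "free_y i r = fps_const (free_gen (Gen_y i r))"

definition poly_at_C :: "complex poly \<Rightarrow> 'n free_alg" where
  "poly_at_C p =
     (\<Sum>k\<le>Polynomial.degree p. Poly_Mapping.single 0 (coeff p k) * free_gen Gen_C ^ k)"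

definition series_at_C :: "complex poly fps \<Rightarrow> 'n free_alg fps" where
  "series_at_C f = Abs_fps (\<lambda>m. poly_at_C (fps_nth f m))"

text \<open>
  The defining relations, the third family being the coefficients of \<open>u\<^sup>-\<^sup>r\<^sup>-\<^sup>1 v\<^sup>-\<^sup>t\<^sup>-\<^sup>1\<close>.  In
  \<open>s\<^sub>i\<^sub>j(v - u, C)\<close> the first variable is \<open>v\<close>, whence the swapped exponents.
\<close>

definition H_relators :: "'n::finite free_alg fps set" where
  "H_relators =
     {free_C * free_y i r - free_y i r * free_C | i r. True} \<union>
     {(\<Sum>i\<in>UNIV. free_y i r) | r. True} \<union>
     {(free_y i r * free_y j t + series_at_C (expand_diff (s_C i j) (- r - 1) (- t - 1))) -
      (free_y j t * free_y i r + series_at_C (expand_diff (s_C i j) (- t - 1) (- r - 1)))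
      | i j r t. True}"

quotient_type 'n H_alg = "'n::finite free_alg fps" / "\<lambda>a b. a - b \<in> closed_ideal H_relators"
  by (rule equivp_closed_ideal)

instantiation H_alg :: (finite) "{ring, monoid_mult}"
begin

lift_definition zero_H_alg :: "'a H_alg" is 0 .
lift_definition one_H_alg :: "'a H_alg" is 1 .
lift_definition plus_H_alg :: "'a H_alg \<Rightarrow> 'a H_alg \<Rightarrow> 'a H_alg" is "(+)"
  by (rule closed_ideal_cong_add)
lift_definition uminus_H_alg :: "'a H_alg \<Rightarrow> 'a H_alg" is uminus
  by (rule closed_ideal_cong_uminus)
lift_definition minus_H_alg :: "'a H_alg \<Rightarrow> 'a H_alg \<Rightarrow> 'a H_alg" is "(-)"
  by (rule closed_ideal_cong_diff)
lift_definition times_H_alg :: "'a H_alg \<Rightarrow> 'a H_alg \<Rightarrow> 'a H_alg" is "(*)"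
  by (rule closed_ideal_cong_mult)

instance
  by standard (transfer, simp add: algebra_simps closed_ideal_0)+

end

text \<open>The structure map \<open>\<complex>[[h]] \<rightarrow> H(C)\<close>.\<close>

lift_definition H_scalar :: "complex fps \<Rightarrow> 'n::finite H_alg" is
  "\<lambda>f. Abs_fps (\<lambda>m. Poly_Mapping.single 0 (fps_nth f m))" .

lift_definition H_C :: "'n::finite H_alg" is free_C .

lift_definition H_y :: "'n::finite \<Rightarrow> int \<Rightarrow> 'n H_alg" is free_y .


definition H_module ::
  "(complex fps \<Rightarrow> 'w::ab_group_add \<Rightarrow> 'w) \<Rightarrow> 'w set \<Rightarrow> ('n::finite H_alg \<Rightarrow> 'w \<Rightarrow> 'w) \<Rightarrow> bool" where
  "H_module s W act \<longleftrightarrow>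
     module s \<and> module.subspace s W \<and>
     (\<forall>a. act a \<in> W \<rightarrow>\<^sub>E W) \<and>
     (\<forall>a. \<forall>v\<in>W. \<forall>w\<in>W. act a (v + w) = act a v + act a w) \<and>
     (\<forall>a b. \<forall>w\<in>W. act (a + b) w = act a w + act b w) \<and>
     (\<forall>a b. \<forall>w\<in>W. act (a * b) w = act a (act b w)) \<and>
     (\<forall>w\<in>W. act 1 w = w) \<and>
     (\<forall>f. \<forall>w\<in>W. act (H_scalar f) w = s f w)"

definition H_level ::
  "(complex fps \<Rightarrow> 'w::ab_group_add \<Rightarrow> 'w) \<Rightarrow> 'w set \<Rightarrow> ('n::finite H_alg \<Rightarrow> 'w \<Rightarrow> 'w) \<Rightarrow> complex \<Rightarrow> bool"
  where "H_level s W act c \<longleftrightarrow> (\<forall>w\<in>W. act H_C w = s (fps_const c) w)"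

text \<open>The coefficient of \<open>u\<^sup>k\<close> in \<open>y\<^sup>i(u)\<close> is \<open>y\<^sub>i\<^sup>(\<^sup>-\<^sup>k\<^sup>-\<^sup>1\<^sup>)\<close>.\<close>

definition y_series :: "('n::finite H_alg \<Rightarrow> 'w \<Rightarrow> 'w) \<Rightarrow> 'n \<Rightarrow> 'w \<Rightarrow> int \<Rightarrow> 'w" where
  "y_series act i w k = act (H_y i (- k - 1)) w"

definition H_restricted ::
  "(complex fps \<Rightarrow> 'w::ab_group_add \<Rightarrow> 'w) \<Rightarrow> 'w set \<Rightarrow> ('n::finite H_alg \<Rightarrow> 'w \<Rightarrow> 'w) \<Rightarrow> bool" where
  "H_restricted s W act \<longleftrightarrow>
     topologically_free s W \<and> (\<forall>i. y_series act i \<in> series_Hom s W (laurent_h s W))"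


section \<open>The algebra \<open>H\<^sup>+\<^sub>N\<close>\<close>

text \<open>
  The polynomial variable indexed by \<open>(i, j, k)\<close> is \<open>x\<^sub>i\<^sub>j\<^sup>(\<^sup>-\<^sup>k\<^sup>-\<^sup>1\<^sup>)\<close>, the coefficient of \<open>u\<^sup>k\<close>
  in \<open>x\<^sup>+\<^sub>i\<^sub>j(u)\<close>.
\<close>

type_synonym 'n x_poly = "(('n \<times> 'n \<times> nat) \<Rightarrow>\<^sub>0 nat) \<Rightarrow>\<^sub>0 complex"

definition x_var :: "'n \<Rightarrow> 'n \<Rightarrow> nat \<Rightarrow> 'n x_poly fps" where
  "x_var i j k = fps_const (Poly_Mapping.single (Poly_Mapping.single (i, j, k) 1) 1)"

definition Hplus_relators :: "'n::finite x_poly fps set" where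
  "Hplus_relators = range (\<lambda>k. \<Sum>i\<in>UNIV. x_var i i k)"

quotient_type 'n Hplus = "'n::finite x_poly fps" / "\<lambda>a b. a - b \<in> closed_ideal Hplus_relators"
  by (rule equivp_closed_ideal)

instantiation Hplus :: (finite) "{comm_ring, comm_monoid_mult}"
begin

lift_definition zero_Hplus :: "'a Hplus" is 0 .
lift_definition one_Hplus :: "'a Hplus" is 1 .
lift_definition plus_Hplus :: "'a Hplus \<Rightarrow> 'a Hplus \<Rightarrow> 'a Hplus" is "(+)"
  by (rule closed_ideal_cong_add)
lift_definition uminus_Hplus :: "'a Hplus \<Rightarrow> 'a Hplus" is uminus
  by (rule closed_ideal_cong_uminus)
lift_definition minus_Hplus :: "'a Hplus \<Rightarrow> 'a Hplus \<Rightarrow> 'a Hplus" is "(-)"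
  by (rule closed_ideal_cong_diff)
lift_definition times_Hplus :: "'a Hplus \<Rightarrow> 'a Hplus \<Rightarrow> 'a Hplus" is "(*)"
  by (rule closed_ideal_cong_mult)

instance
  by standard (transfer, simp add: algebra_simps closed_ideal_0)+

end

lift_definition Hplus_scalar :: "complex fps \<Rightarrow> 'n::finite Hplus" is
  "\<lambda>f. Abs_fps (\<lambda>m. Poly_Mapping.single 0 (fps_nth f m))" .

definition Hplus_scale :: "complex fps \<Rightarrow> 'n::finite Hplus \<Rightarrow> 'n Hplus" where
  "Hplus_scale f w = Hplus_scalar f * w"

lift_definition Hplus_x :: "'n::finite \<Rightarrow> 'n \<Rightarrow> nat \<Rightarrow> 'n Hplus" is x_var .

definition x_plus :: "'n::finite \<Rightarrow> 'n \<Rightarrow> int \<Rightarrow> 'n Hplus" where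
  "x_plus i j k = (if k \<ge> 0 then Hplus_x i j (nat k) else 0)"


section \<open>Series with tensor products of matrices as coefficients\<close>

text \<open>
  An element \<open>T\<close> of \<open>(End \<complex>\<^sup>N)\<^sup>\<otimes>\<^sup>n \<otimes> W\<close>, with \<open>W\<close>-valued formal series in \<open>u\<^sub>1, \<dots>, u\<^sub>n\<close>, is given
  by its coefficients: \<^term>\<open>T [(i\<^sub>1, j\<^sub>1), (i\<^sub>2, j\<^sub>2)] [k\<^sub>1, k\<^sub>2]\<close> is the coefficient of
  \<open>e\<^bsub>i\<^sub>1j\<^sub>1\<^esub> \<otimes> e\<^bsub>i\<^sub>2j\<^sub>2\<^esub>\<close> and of \<open>u\<^sub>1\<close>, \<open>u\<^sub>2\<close> to the powers \<open>k\<^sub>1\<close>, \<open>k\<^sub>2\<close>.  It is zero when the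
  lengths of the lists do not fit.
\<close>

type_synonym ('n, 'w) tensor_series = "('n \<times> 'n) list \<Rightarrow> int list \<Rightarrow> 'w"

definition diag :: "('n, 'w::zero) tensor_series \<Rightarrow> ('n, 'w) tensor_series" where
  "diag T = (\<lambda>ps ks. if \<forall>p\<in>set ps. fst p = snd p then T ps ks else 0)"

text \<open>An operator \<open>A(u)\<close> in \<open>End \<complex>\<^sup>N \<otimes> Hom(W, W[[u\<^sup>\<plusminus>\<^sup>1]])\<close>, by its matrix entries.\<close>

type_synonym ('n, 'w) op_series = "'n \<Rightarrow> 'n \<Rightarrow> 'w \<Rightarrow> int \<Rightarrow> 'w"

text \<open>The application of \<open>A\<^sub>0(u\<^sub>0)\<close> puts the matrix factor and the variable with label 0 in front.\<close>

fun apply_0 :: "('n, 'w::zero) op_series \<Rightarrow> ('n, 'w) tensor_series \<Rightarrow> ('n, 'w) tensor_series" where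
  "apply_0 A T ((i, j) # ps) (k # ks) = A i j (T ps ks) k"
| "apply_0 A T _ _ = 0"

definition x_plus_tensor :: "nat \<Rightarrow> ('n::finite, 'n Hplus) tensor_series" where
  "x_plus_tensor n ps ks =
     (if length ps = n \<and> length ks = n
      then \<Prod>l<n. x_plus (fst (ps ! l)) (snd (ps ! l)) (ks ! l) else 0)"

text \<open>
  \<^term>\<open>S_0j_tensor c n j\<close> is
  \<open>S\<^sub>0\<^sub>j(u\<^sub>0 - u\<^sub>j) x\<^sup>+\<^sub>1(u\<^sub>1) \<dots> x\<^sup>+\<^sub>j\<^sub>-\<^sub>1(u\<^sub>j\<^sub>-\<^sub>1) x\<^sup>+\<^sub>j\<^sub>+\<^sub>1(u\<^sub>j\<^sub>+\<^sub>1) \<dots> x\<^sup>+\<^sub>n(u\<^sub>n)\<close>.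
\<close>

definition S_0j_tensor :: "complex \<Rightarrow> nat \<Rightarrow> nat \<Rightarrow> ('n::finite, 'n Hplus) tensor_series" where
  "S_0j_tensor c n j ps ks =
     (if length ps = Suc n \<and> length ks = Suc n
      then Hplus_scale
             (expand_diff (S_at c $ (fst (ps ! 0), fst (ps ! j)) $ (snd (ps ! 0), snd (ps ! j)))
                (ks ! 0) (ks ! j))
             (x_plus_tensor (n - 1) (nths ps (- {0, j})) (nths ks (- {0, j})))
      else 0)"


section \<open>The operators x\<close>

definition is_x_minus :: "complex \<Rightarrow> ('n::finite, 'n Hplus) op_series \<Rightarrow> bool" where
  "is_x_minus c X \<longleftrightarrow>
     (\<forall>i j. X i j \<in> series_Hom Hplus_scale UNIV (inv_poly_h Hplus_scale UNIV)) \<and>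
     (\<forall>i j w. \<forall>k\<ge>0. X i j w k = 0) \<and>
     (\<forall>i j k. X i j 1 k = 0) \<and>
     (\<forall>n\<ge>1. \<forall>ps ks. apply_0 X (x_plus_tensor n) ps ks = - (\<Sum>j=1..n. S_0j_tensor c n j ps ks))"

definition x_minus :: "complex \<Rightarrow> ('n::finite, 'n Hplus) op_series" where
  "x_minus c = (THE X. is_x_minus c X)"

definition x_op :: "complex \<Rightarrow> ('n::finite, 'n Hplus) op_series" where
  "x_op c i j w k = x_plus i j k * w + x_minus c i j w k"

text \<open>\<open>\<V>\<^sub>H(c)\<close>; as a \<open>\<complex>[[h]]\<close>-algebra it does not depend on \<open>c\<close>.\<close>

definition Hplus_subalgebra :: "'n::finite Hplus set \<Rightarrow> bool" where
  "Hplus_subalgebra A \<longleftrightarrow>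
     module.subspace Hplus_scale A \<and> 1 \<in> A \<and> (\<forall>v\<in>A. \<forall>w\<in>A. v * w \<in> A)"

definition V_H :: "'n::finite Hplus set" where
  "V_H = \<Inter>{A. Hplus_subalgebra A \<and> topologically_free Hplus_scale A \<and> (\<forall>i k. Hplus_x i i k \<in> A)}"

definition y_op :: "('n::finite H_alg \<Rightarrow> 'w::zero \<Rightarrow> 'w) \<Rightarrow> ('n, 'w) op_series" where
  "y_op act i j w k = (if i = j then y_series act i w k else 0)"


section \<open>The abelian Lie algebra\<close>

text \<open>
  The space generated by \<open>a\<^sub>1, \<dots>, a\<^sub>N\<close> with the relation \<open>a\<^sub>1 + \<dots> + a\<^sub>N = 0\<close> is the quotient of
  \<open>\<complex>\<^sup>N\<close> by the constant vectors.
\<close>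

quotient_type 'n cartan = "complex ^ 'n::finite" / "\<lambda>v w. \<exists>t. v - w = (\<chi> i. t)"
proof (rule equivpI)
  show "reflp (\<lambda>v w :: complex ^ 'n. \<exists>t. v - w = (\<chi> i. t))"
    by (auto simp: reflp_def vec_eq_iff)
  show "symp (\<lambda>v w :: complex ^ 'n. \<exists>t. v - w = (\<chi> i. t))"
  proof (rule sympI)
    fix v w :: "complex ^ 'n"
    assume "\<exists>t. v - w = (\<chi> i. t)"
    then obtain t where "v - w = (\<chi> i. t)" ..
    then have "w - v = (\<chi> i. - t)"
      by (simp add: vec_eq_iff) (metis minus_diff_eq)
    then show "\<exists>t. w - v = (\<chi> i. t)" ..
  qed
  show "transp (\<lambda>v w :: complex ^ 'n. \<exists>t. v - w = (\<chi> i. t))"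
  proof (rule transpI)
    fix v w z :: "complex ^ 'n"
    assume "\<exists>t. v - w = (\<chi> i. t)" "\<exists>t. w - z = (\<chi> i. t)"
    then obtain t t' where "v - w = (\<chi> i. t)" "w - z = (\<chi> i. t')" by blast
    then have "v - z = (\<chi> i. t + t')"
      by (simp add: vec_eq_iff algebra_simps)
    then show "\<exists>t. v - z = (\<chi> i. t)" ..
  qed
qed

instantiation cartan :: (finite) ab_group_add
begin

lift_definition zero_cartan :: "'a cartan" is 0 .
lift_definition plus_cartan :: "'a cartan \<Rightarrow> 'a cartan \<Rightarrow> 'a cartan" is "(+)"
proof -
  fix v v' w w' :: "complex ^ 'a"
  assume "\<exists>t. v - v' = (\<chi> i. t)" "\<exists>t. w - w' = (\<chi> i. t)"
  then obtain t t' where "v - v' = (\<chi> i. t)" "w - w' = (\<chi> i. t')" by blast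
  then have "(v + w) - (v' + w') = (\<chi> i. t + t')"
    by (simp add: vec_eq_iff add_diff_add)
  then show "\<exists>t. (v + w) - (v' + w') = (\<chi> i. t)" ..
qed
lift_definition uminus_cartan :: "'a cartan \<Rightarrow> 'a cartan" is uminus
proof -
  fix v v' :: "complex ^ 'a"
  assume "\<exists>t. v - v' = (\<chi> i. t)"
  then obtain t where "v - v' = (\<chi> i. t)" ..
  then have "(- v) - (- v') = (\<chi> i. - t)"
    by (simp add: vec_eq_iff) (metis minus_diff_eq)
  then show "\<exists>t. (- v) - (- v') = (\<chi> i. t)" ..
qed
definition minus_cartan :: "'a cartan \<Rightarrow> 'a cartan \<Rightarrow> 'a cartan" where
  "minus_cartan v w = v + - w"

instance
proof
  fix v w z :: "'a cartan"
  show "v + w + z = v + (w + z)" by transfer (auto simp: vec_eq_iff)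
  show "v + w = w + v" by transfer (auto simp: vec_eq_iff)
  show "0 + v = v" by transfer (auto simp: vec_eq_iff)
  show "- v + v = 0" by transfer (auto simp: vec_eq_iff)
  show "v - w = v + - w" by (rule minus_cartan_def)
qed

end

lift_definition cartan_a :: "'n::finite \<Rightarrow> 'n cartan" is "\<lambda>i. axis i 1" .

lemma sum_sum_delta_minus_inverse_card:
  fixes v w :: "complex ^ 'n::finite"
  shows "(\<Sum>i\<in>UNIV. \<Sum>j\<in>UNIV.
            v $ i * w $ j * ((if i = j then 1 else 0) - 1 / of_nat CARD('n))) =
         (\<Sum>i\<in>UNIV. v $ i * w $ i) -
         (\<Sum>i\<in>UNIV. v $ i) * (\<Sum>i\<in>UNIV. w $ i) / of_nat CARD('n)"
  by (simp add: right_diff_distrib sum_subtractf if_distrib[of "(*) _"] sum_product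
      sum_divide_distrib cong: if_cong)

lift_definition cartan_form :: "'n::finite cartan \<Rightarrow> 'n cartan \<Rightarrow> complex" is
  "\<lambda>v w. \<Sum>i\<in>UNIV. \<Sum>j\<in>UNIV.
     v $ i * w $ j * ((if i = j then 1 else 0) - 1 / of_nat CARD('n))"
proof -
  fix v v' w w' :: "complex ^ 'n"
  assume "\<exists>t. v - v' = (\<chi> i. t)" "\<exists>t. w - w' = (\<chi> i. t)"
  then obtain t t' where "\<forall>i. v $ i = v' $ i + t" "\<forall>i. w $ i = w' $ i + t'"
    by (auto simp: vec_eq_iff algebra_simps)
  then show "(\<Sum>i\<in>UNIV. \<Sum>j\<in>UNIV.
        v $ i * w $ j * ((if i = j then 1 else 0) - 1 / of_nat CARD('n))) =
      (\<Sum>i\<in>UNIV. \<Sum>j\<in>UNIV.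
        v' $ i * w' $ j * ((if i = j then 1 else 0) - 1 / of_nat CARD('n)))"
    unfolding sum_sum_delta_minus_inverse_card
    by (simp add: algebra_simps sum.distrib sum_distrib_left[symmetric]
        sum_distrib_right[symmetric] add_divide_distrib)
qed

lemma cartan_form_a:
  "cartan_form (cartan_a i) (cartan_a j :: 'n::finite cartan) =
     (if i = j then 1 else 0) - 1 / of_nat CARD('n)"
  by transfer (simp add: axis_def sum_sum_delta_minus_inverse_card if_distrib[of "\<lambda>x. x * _"]
      if_distrib[of "(*) _"] cong: if_cong)

text \<open>The \<open>\<complex>[[h]]\<close>-bilinear extension to power series over the space.\<close>

definition cartan_form_h :: "'n::finite cartan fps \<Rightarrow> 'n cartan fps \<Rightarrow> complex fps" where
  "cartan_form_h \<alpha> \<beta> =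
     Abs_fps (\<lambda>m. \<Sum>k\<le>m. cartan_form (fps_nth \<alpha> k) (fps_nth \<beta> (m - k)))"

definition a_mat :: "'n::finite cartan fps \<Rightarrow> complex fps ^ 'n ^ 'n" where
  "a_mat \<alpha> = (\<chi> i j. if i = j then cartan_form_h (fps_const (cartan_a i)) \<alpha> else 0)"

text \<open>The operator \<open>x(u) + u\<^sup>-\<^sup>1 a(\<alpha>)\<close>.\<close>

definition x_a_op :: "complex \<Rightarrow> 'n::finite cartan fps \<Rightarrow> ('n, 'n Hplus) op_series" where
  "x_a_op c \<alpha> i j w k =
     x_op c i j w k + (if k = - 1 then Hplus_scale (a_mat \<alpha> $ i $ j) w else 0)"

end

theory Submission
  imports Defs
begin

text \<open>
  Elements of \<open>H\<^sup>+\<^sub>N\<close> are written in normal form as power series in \<open>h\<close> over the polynomials fixed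
  by the substitution \<open>x\<^sub>i\<^sub>i \<mapsto> x\<^sub>i\<^sub>i - (x\<^sub>1\<^sub>1 + \<dots> + x\<^sub>N\<^sub>N)/N\<close>.  From this the module is topologically free, and
  a \<open>\<complex>[[h]]\<close>-linear map is determined by its values on the products of generators; this gives both
  uniqueness statements (for \<open>x\<^sup>-\<close> and for the action).

  The formula defining \<open>x\<^sup>-(u)\<close> is the Leibniz rule: its coefficients are the derivations with
  scalar values \<open>x\<^sup>+(v) \<mapsto> - S(u - v)\<close> on generators, which are compatible with the relations because
  the partial traces of \<open>S\<close> vanish.  Such derivations commute with each other, so the commutator of
  the operators \<open>x\<^sub>i\<^sub>i(u) + u\<^sup>-\<^sup>1 \<langle>a\<^sub>i, \<alpha>\<rangle>\<close> and \<open>x\<^sub>j\<^sub>j(v) + v\<^sup>-\<^sup>1 \<langle>a\<^sub>j, \<alpha>\<rangle>\<close> is the scalar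
  \<open>s\<^sub>i\<^sub>j(v - u) - s\<^sub>i\<^sub>j(u - v)\<close>, which is the defining relation of \<open>H(C)\<close>.
\<close>

section \<open>Polynomials\<close>

text \<open>Two points shape the argument. One device deals with this: if every member of a family
  is h times another member, all members vanish, because the module is separated. Applied to the
  defect of an identity, it replaces limits and Cauchy products by the splitting f = f_0 + h f'.
  Second, the two partial traces of S do different jobs. Vanishing of tr_2 makes the derivations
  respect x_11 + ... + x_NN = 0 in the factor on which they act; vanishing of tr_1 gives y^1 + ... +
  y^N = 0 for the operators. The term with \<alpha> is scalar, so it changes no commutator, and it
  respects this last relation because the a_i sum to zero. Finally s_ij = s_ji, as S is a
  combination of I and P; this allows both cross terms of a commutator to be written with the one
  series s_ij.\<close>

definition poly_const :: "complex \<Rightarrow> ('v \<Rightarrow>\<^sub>0 nat) \<Rightarrow>\<^sub>0 complex" where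
  "poly_const a = Poly_Mapping.single 0 a"

definition poly_var :: "'v \<Rightarrow> ('v \<Rightarrow>\<^sub>0 nat) \<Rightarrow>\<^sub>0 complex" where
  "poly_var v = Poly_Mapping.single (Poly_Mapping.single v 1) 1"

lemma poly_const_0 [simp]: "poly_const 0 = 0"
  and poly_const_1 [simp]: "poly_const 1 = 1"
  and poly_const_add: "poly_const (a + b) = poly_const a + poly_const b"
  and poly_const_mult: "poly_const (a * b) = poly_const a * poly_const b"
  by (simp_all add: poly_const_def single_add mult_single)

lemma poly_const_of_nat: "poly_const (of_nat n) = of_nat n"
  by (simp add: poly_const_def)

text \<open>The rules peel off one variable at a time, which is the form in which substitutions and
  the Leibniz rule are applied. \<open>K\<close> will be the set of all variables or that of the
  diagonal ones.\<close>

inductive_set polys :: "'v set \<Rightarrow> (('v \<Rightarrow>\<^sub>0 nat) \<Rightarrow>\<^sub>0 complex) set" for K where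
  const: "poly_const a \<in> polys K"
| add: "p \<in> polys K \<Longrightarrow> q \<in> polys K \<Longrightarrow> p + q \<in> polys K"
| var_mult: "v \<in> K \<Longrightarrow> p \<in> polys K \<Longrightarrow> poly_var v * p \<in> polys K"

lemma polys_0: "0 \<in> polys K"
  using polys.const[of 0 K] by simp

lemma polys_sum: "(\<And>i. i \<in> I \<Longrightarrow> f i \<in> polys K) \<Longrightarrow> sum f I \<in> polys K"
  by (induction I rule: infinite_finite_induct) (auto intro: polys_0 polys.add)

lemma polys_var: "v \<in> K \<Longrightarrow> poly_var v \<in> polys K"
  using polys.var_mult[OF _ polys.const[of 1 K]] by simp

lemma polys_mult:
  assumes "p \<in> polys K" "q \<in> polys K"
  shows "p * q \<in> polys K"
  using assms(1)
proof induction
  case (const a)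
  show ?case
    using assms(2)
  proof induction
    case (var_mult v p)
    then show ?case
      using polys.var_mult[of v K "poly_const a * p"] by (simp add: mult.left_commute)
  qed (simp_all add: poly_const_mult[symmetric] polys.const polys.add distrib_left)
qed (simp_all add: polys.add polys.var_mult distrib_right mult.assoc)

lemma polys_diff: "p \<in> polys K \<Longrightarrow> q \<in> polys K \<Longrightarrow> p - q \<in> polys K"
  using polys.add[OF _ polys_mult[OF polys.const[of "-1"]], of p K q]
  by (simp add: poly_const_def single_uminus)

lemma poly_mapping_sum_single:
  "(\<Sum>k\<in>Poly_Mapping.keys p. Poly_Mapping.single k (Poly_Mapping.lookup p k)) = p"
  by (rule poly_mapping_eqI)
    (simp add: lookup_sum lookup_single when_def in_keys_iff)

lemma poly_mapping_single_induct [case_names single add]: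
  fixes p :: "'k \<Rightarrow>\<^sub>0 'b::comm_monoid_add"
  assumes "\<And>k a. P (Poly_Mapping.single k a)"
    and "\<And>p q. P p \<Longrightarrow> P q \<Longrightarrow> P (p + q)"
  shows "P p"
proof -
  have "P (\<Sum>k\<in>A. Poly_Mapping.single k (Poly_Mapping.lookup p k))" if "finite A" for A
    using that
  proof induction
    case empty
    then show ?case using assms(1)[of undefined 0] by simp
  qed (simp add: assms)
  from this[OF finite_keys[of p]] show ?thesis
    by (simp add: poly_mapping_sum_single)
qed

lemma monomial_in_polys: "Poly_Mapping.single m a \<in> polys UNIV"
proof -
  have *: "Poly_Mapping.single (Poly_Mapping.single v n + m) a \<in> polys UNIV"
    if "Poly_Mapping.single m a \<in> polys UNIV" for v n and m :: "'a \<Rightarrow>\<^sub>0 nat"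
  proof (induction n)
    case (Suc n)
    have "Poly_Mapping.single (Poly_Mapping.single v (Suc n) + m) a =
        poly_var v * Poly_Mapping.single (Poly_Mapping.single v n + m) a"
      by (simp add: poly_var_def mult_single add.assoc[symmetric] single_add[symmetric])
    then show ?case
      using Suc by (simp add: polys.var_mult)
  qed (use that in simp)
  have "Poly_Mapping.single (\<Sum>v\<in>A. Poly_Mapping.single v (Poly_Mapping.lookup m v)) a \<in> polys UNIV"
    if "finite A" for A
    using that
    by induction (use polys.const[of a UNIV] in \<open>auto simp: poly_const_def intro: *\<close>)
  from this[OF finite_keys[of m]] show ?thesis
    by (simp add: poly_mapping_sum_single)
qed

lemma polys_UNIV: "p \<in> polys UNIV"
  by (induction p rule: poly_mapping_single_induct) (auto intro: monomial_in_polys polys.add)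

subsection \<open>Substitution\<close>

text \<open>The summands are meant to be additive in the coefficient.\<close>

definition linear_ext :: "('k \<Rightarrow> 'b \<Rightarrow> 'm) \<Rightarrow> ('k \<Rightarrow>\<^sub>0 'b::zero) \<Rightarrow> 'm::comm_monoid_add" where
  "linear_ext g p = (\<Sum>k\<in>Poly_Mapping.keys p. g k (Poly_Mapping.lookup p k))"

lemma linear_ext_single: "g k 0 = 0 \<Longrightarrow> linear_ext g (Poly_Mapping.single k a) = g k a"
  by (simp add: linear_ext_def)

lemma linear_ext_add:
  assumes "\<And>k. g k 0 = 0" and "\<And>k a b. g k (a + b) = g k a + g k b"
  shows "linear_ext g (p + q) = linear_ext g p + linear_ext g q"
  unfolding linear_ext_def using assms by (intro setsum_keys_plus_distrib)

definition subst ::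
  "(complex \<Rightarrow> 'r) \<Rightarrow> ('v \<Rightarrow> 'r) \<Rightarrow> (('v \<Rightarrow>\<^sub>0 nat) \<Rightarrow>\<^sub>0 complex) \<Rightarrow> 'r::comm_ring_1" where
  "subst e \<sigma> = linear_ext (\<lambda>m a. e a * (\<Prod>v\<in>Poly_Mapping.keys m. \<sigma> v ^ Poly_Mapping.lookup m v))"

definition scalar_hom :: "(complex \<Rightarrow> 'r::comm_ring_1) \<Rightarrow> bool" where
  "scalar_hom e \<longleftrightarrow>
     e 1 = 1 \<and> (\<forall>a b. e (a + b) = e a + e b) \<and> (\<forall>a b. e (a * b) = e a * e b)"

context
  fixes e :: "complex \<Rightarrow> 'r::comm_ring_1" and \<sigma> :: "'v \<Rightarrow> 'r"
  assumes e: "scalar_hom e"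
begin

lemma scalar_hom_0: "e 0 = 0"
  using e unfolding scalar_hom_def by (metis add_cancel_right_left)

lemma subst_add: "subst e \<sigma> (p + q) = subst e \<sigma> p + subst e \<sigma> q"
  unfolding subst_def using e
  by (intro linear_ext_add) (auto simp: scalar_hom_def scalar_hom_0 distrib_right)

lemma subst_single:
  "subst e \<sigma> (Poly_Mapping.single m a) =
     e a * (\<Prod>v\<in>Poly_Mapping.keys m. \<sigma> v ^ Poly_Mapping.lookup m v)"
  unfolding subst_def by (simp add: linear_ext_single scalar_hom_0)

lemma subst_mult: "subst e \<sigma> (p * q) = subst e \<sigma> p * subst e \<sigma> q"
proof (induction p rule: poly_mapping_single_induct)
  case (single m a)
  show ?case
  proof (induction q rule: poly_mapping_single_induct)
    case (single m' b)
    \<comment> \<open>The supports of \<open>m\<close>, \<open>m'\<close> and \<open>m + m'\<close>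
      can differ; all three products are extended to the common union, where an absent variable
      contributes a zeroth power.\<close>
    have *: "(\<Prod>v\<in>Poly_Mapping.keys k. \<sigma> v ^ Poly_Mapping.lookup k v) =
        (\<Prod>v\<in>Poly_Mapping.keys m \<union> Poly_Mapping.keys m'. \<sigma> v ^ Poly_Mapping.lookup k v)"
      if "Poly_Mapping.keys k \<subseteq> Poly_Mapping.keys m \<union> Poly_Mapping.keys m'" for k
      using that by (intro prod.mono_neutral_left) (auto simp: in_keys_iff)
    show ?case
      using e *[of m] *[of m'] *[of "m + m'"] keys_add[of m m']
      by (simp add: mult_single subst_single lookup_add power_add prod.distrib
          scalar_hom_def mult_ac add.commute[of m' m])
  qed (simp add: distrib_left subst_add)
qed (simp add: distrib_right subst_add)

lemma subst_const: "subst e \<sigma> (poly_const a) = e a"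
  by (simp add: poly_const_def subst_single)

lemma subst_var: "subst e \<sigma> (poly_var v) = \<sigma> v"
  using e by (simp add: poly_var_def subst_single scalar_hom_def)

lemma subst_0: "subst e \<sigma> 0 = 0"
  using subst_const[of 0] by (simp add: scalar_hom_0)

lemma subst_sum: "subst e \<sigma> (sum f I) = (\<Sum>i\<in>I. subst e \<sigma> (f i))"
  by (induction I rule: infinite_finite_induct) (simp_all add: subst_0 subst_add)

lemma subst_diff: "subst e \<sigma> (p - q) = subst e \<sigma> p - subst e \<sigma> q"
  using subst_add[of "p - q" q] by simp

end

text \<open>A derivation is read off a homomorphism into the dual numbers.\<close>

definition derivation ::
  "('v \<Rightarrow> complex fps) \<Rightarrow> (('v \<Rightarrow>\<^sub>0 nat) \<Rightarrow>\<^sub>0 complex) \<Rightarrow> (('v \<Rightarrow>\<^sub>0 nat) \<Rightarrow>\<^sub>0 complex) fps" where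
  "derivation d p =
     coeff (subst (\<lambda>a. [:fps_const (poly_const a):])
              (\<lambda>v. [:fps_const (poly_var v), Abs_fps (\<lambda>m. poly_const (fps_nth (d v) m)):]) p) 1"

lemma scalar_hom_dual: "scalar_hom (\<lambda>a. [:fps_const (poly_const a):])"
  by (simp add: scalar_hom_def poly_const_add poly_const_mult flip: fps_const_add fps_const_mult
      one_pCons)

lemma derivation_const: "derivation d (poly_const a) = 0"
  and derivation_add: "derivation d (p + q) = derivation d p + derivation d q"
  and derivation_var: "derivation d (poly_var v) = Abs_fps (\<lambda>m. poly_const (fps_nth (d v) m))"
  by (simp_all add: derivation_def subst_const subst_add subst_var scalar_hom_dual)

lemma derivation_mult:
  "derivation d (p * q) = derivation d p * fps_const q + fps_const p * derivation d q"
proof -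
  let ?s = "subst (\<lambda>a. [:fps_const (poly_const a):])
              (\<lambda>v. [:fps_const (poly_var v), Abs_fps (\<lambda>m. poly_const (fps_nth (d v) m)):])"
  \<comment> \<open>The coefficient of degree 1 in a product involves only the coefficients of
    degrees 0 and 1, so a polynomial variable serves as the dual-number unit. With degree 0 equal to
    the polynomial itself, this is the Leibniz rule.\<close>
  have "coeff (?s p) 0 = fps_const p" for p
    using polys_UNIV[of p]
  proof induction
    case (add p q)
    then show ?case by (simp add: subst_add scalar_hom_dual)
  next
    case (var_mult v p)
    then show ?case by (simp add: subst_mult subst_var scalar_hom_dual coeff_mult_0)
  qed (simp add: subst_const scalar_hom_dual)
  then show ?thesis
    by (simp add: derivation_def subst_mult scalar_hom_dual coeff_mult)
qed

section \<open>The algebra \<open>H\<^sup>+\<^sub>N\<close> as a topologically free module\<close>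

lemma closed_fps_iff:
  fixes I :: "'a::group_add fps set"
  shows "closed I \<longleftrightarrow>
    (\<forall>f. (\<forall>n. \<exists>g\<in>I. \<forall>j\<le>n. fps_nth g j = fps_nth f j) \<longrightarrow> f \<in> I)"
proof
  assume "closed I"
  show "\<forall>f. (\<forall>n. \<exists>g\<in>I. \<forall>j\<le>n. fps_nth g j = fps_nth f j) \<longrightarrow> f \<in> I"
  proof (intro allI impI, rule ccontr)
    fix f assume f: "\<forall>n. \<exists>g\<in>I. \<forall>j\<le>n. fps_nth g j = fps_nth f j" "f \<notin> I"
    with \<open>closed I\<close> obtain r where r: "r > 0" "{y. dist y f < r} \<subseteq> - I"
      unfolding closed_def open_fps_def by (meson ComplI)
    \<comment> \<open>Series that agree up to degree n are at distance below 2^-n, so a ball of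
      radius r contains a whole class modulo h^(n+1).\<close>
    obtain n where "(1/2) ^ n < r"
      using real_arch_pow_inv[of r "1/2"] r(1) by auto
    then have n: "inverse (2 ^ n) < r"
      by (simp add: power_one_over inverse_eq_divide)
    obtain g where "g \<in> I" "\<forall>j\<le>n. fps_nth g j = fps_nth f j"
      using f(1) by blast
    then have "dist g f < r"
      using n dist_less_eq_nth_equal[of g f n] by force
    with r(2) \<open>g \<in> I\<close> show False by blast
  qed
next
  assume *: "\<forall>f. (\<forall>n. \<exists>g\<in>I. \<forall>j\<le>n. fps_nth g j = fps_nth f j) \<longrightarrow> f \<in> I"
  show "closed I"
    unfolding closed_def open_fps_def
  proof
    fix f assume "f \<in> - I"
    then have "f \<notin> I" by simp
    then have "\<not> (\<forall>n. \<exists>g\<in>I. \<forall>j\<le>n. fps_nth g j = fps_nth f j)"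
      using *[rule_format, of f] by metis
    then obtain n where n: "\<forall>g\<in>I. \<exists>j\<le>n. fps_nth g j \<noteq> fps_nth f j"
      by metis
    have "{y. dist y f < inverse (2 ^ n)} \<subseteq> - I"
    proof
      fix y assume "y \<in> {y. dist y f < inverse (2 ^ n)}"
      then have "\<forall>j\<le>n. fps_nth y j = fps_nth f j"
        by (simp add: dist_less_eq_nth_equal)
      with n show "y \<in> - I" by blast
    qed
    then show "\<exists>r>0. {y. dist y f < r} \<subseteq> - I"
      by (intro exI[of _ "inverse (2 ^ n)"]) simp
  qed
qed

lemma closed_closed_ideal: "closed (closed_ideal X)"
  unfolding closed_ideal_def by (intro closed_Inter) auto

lemma closed_ideal_superset: "X \<subseteq> closed_ideal X"
  unfolding closed_ideal_def by auto

lemma closed_ideal_least: "two_sided_ideal I \<Longrightarrow> closed I \<Longrightarrow> X \<subseteq> I \<Longrightarrow> closed_ideal X \<subseteq> I"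
  unfolding closed_ideal_def by auto

lemma closed_ideal_limit:
  assumes "\<And>n. \<exists>g\<in>closed_ideal X. \<forall>j\<le>n. fps_nth g j = fps_nth f j"
  shows "f \<in> closed_ideal X"
  using assms closed_closed_ideal[of X] unfolding closed_fps_iff by blast

lemma closed_ideal_sum: "(\<And>i. i \<in> I \<Longrightarrow> f i \<in> closed_ideal X) \<Longrightarrow> sum f I \<in> closed_ideal X"
  by (induction I rule: infinite_finite_induct) (auto intro: closed_ideal_0 closed_ideal_add)

text \<open>The truncations of \<open>f\<close> are finite combinations of its coefficients with
  powers of h, hence lie in the ideal, and they converge h-adically to \<open>f\<close>.\<close>

lemma closed_ideal_coefficientwise:
  assumes "\<And>n. fps_const (fps_nth f n) \<in> closed_ideal X"
  shows "f \<in> closed_ideal X"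
proof (rule closed_ideal_limit)
  fix n
  let ?g = "\<Sum>i\<le>n. fps_const (fps_nth f i) * fps_X ^ i"
  have "fps_nth ?g j = fps_nth f j" if "j \<le> n" for j
    using that by (simp add: fps_sum_nth if_distrib cong: if_cong)
  moreover have "?g \<in> closed_ideal X"
    by (intro closed_ideal_sum closed_ideal_mult_right assms)
  ultimately show "\<exists>g\<in>closed_ideal X. \<forall>j\<le>n. fps_nth g j = fps_nth f j"
    by blast
qed

text \<open>
  The quotient is split by the projection onto polynomials in the \<open>x\<^sub>i\<^sub>j\<close>, \<open>i \<noteq> j\<close>, and the
  differences of the \<open>x\<^sub>i\<^sub>i\<close> from their average; it serves as a normal form.
\<close>

definition avg_var :: "nat \<Rightarrow> 'n::finite x_poly" where
  "avg_var k = poly_const (1 / of_nat CARD('n)) * (\<Sum>l\<in>UNIV. poly_var (l, l, k))"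

definition traceless :: "'n::finite x_poly \<Rightarrow> 'n x_poly" where
  "traceless = subst poly_const (\<lambda>(i, j, k). poly_var (i, j, k) - (if i = j then avg_var k else 0))"

lemma scalar_hom_poly_const: "scalar_hom poly_const"
  by (simp add: scalar_hom_def poly_const_add poly_const_mult)

lemma traceless_add: "traceless (p + q) = traceless p + traceless q"
  unfolding traceless_def by (rule subst_add[OF scalar_hom_poly_const])

lemma traceless_mult: "traceless (p * q) = traceless p * traceless q"
  unfolding traceless_def by (rule subst_mult[OF scalar_hom_poly_const])

lemma traceless_const: "traceless (poly_const a) = poly_const a"
  unfolding traceless_def by (rule subst_const[OF scalar_hom_poly_const])

lemma traceless_0: "traceless 0 = 0"
  unfolding traceless_def by (rule subst_0[OF scalar_hom_poly_const])

lemma traceless_sum: "traceless (sum f I) = (\<Sum>i\<in>I. traceless (f i))"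
  unfolding traceless_def by (rule subst_sum[OF scalar_hom_poly_const])

lemma traceless_diff: "traceless (p - q) = traceless p - traceless q"
  unfolding traceless_def by (rule subst_diff[OF scalar_hom_poly_const])

lemmas traceless_hom =
  traceless_add traceless_mult traceless_const traceless_0 traceless_sum traceless_diff

lemma traceless_1: "traceless 1 = 1"
  unfolding poly_const_1[symmetric] by (rule traceless_const)

lemma traceless_var:
  "traceless (poly_var (i, j, k)) = poly_var (i, j, k) - (if i = j then avg_var k else 0)"
  unfolding traceless_def by (simp add: subst_var[OF scalar_hom_poly_const])

text \<open>Each of the N diagonal variables loses the average, so their sum loses N times the
  average, which is the sum itself.\<close>

lemma traceless_sum_diag: "traceless (\<Sum>l\<in>UNIV. poly_var (l, l, k)) = (0 :: 'n::finite x_poly)"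
proof -
  have "of_nat CARD('n) * (avg_var k :: 'n x_poly) = (\<Sum>l\<in>UNIV. poly_var (l, l, k))"
    unfolding avg_var_def mult.assoc[symmetric] poly_const_of_nat[symmetric]
      poly_const_mult[symmetric] by simp
  then show ?thesis
    by (simp add: traceless_hom traceless_var sum_subtractf)
qed

lemma traceless_avg_var: "traceless (avg_var k) = 0"
  by (simp add: avg_var_def traceless_mult traceless_sum_diag)

lemma traceless_idem: "traceless (traceless p) = traceless p"
  using polys_UNIV[of p]
proof induction
  case (var_mult v p)
  obtain i j k where "v = (i, j, k)" by (cases v)
  with var_mult show ?case
    by (simp add: traceless_hom traceless_var traceless_avg_var)
qed (simp_all add: traceless_hom)

text \<open>The relators put \<open>avg_var k\<close> into the ideal, so the substitution moves no
  variable modulo the ideal, and this passes to sums and products.\<close>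

lemma diff_traceless_in_ideal: "fps_const (p - traceless p) \<in> closed_ideal Hplus_relators"
  using polys_UNIV[of p]
proof induction
  case (const a)
  show ?case by (simp add: traceless_hom closed_ideal_0)
next
  case (add p q)
  have "fps_const (p + q - traceless (p + q)) =
      fps_const (p - traceless p) + fps_const (q - traceless q)"
    by (simp add: traceless_hom add_diff_add)
  then show ?case using add closed_ideal_add by metis
next
  case (var_mult v p)
  obtain i j k where v: "v = (i, j, k)" by (cases v)
  have "fps_const (\<Sum>l\<in>UNIV. poly_var (l, l, k)) \<in> closed_ideal Hplus_relators"
  proof (rule subsetD[OF closed_ideal_superset])
    have "fps_const (\<Sum>l\<in>UNIV. poly_var (l, l, k)) = (\<Sum>l\<in>UNIV. x_var l l k)"
      unfolding x_var_def poly_var_def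
      by (rule fps_ext) (simp add: fps_sum_nth)
    then show "fps_const (\<Sum>l\<in>UNIV. poly_var (l, l, k)) \<in> Hplus_relators"
      unfolding Hplus_relators_def by blast
  qed
  then have avg: "fps_const (avg_var k) \<in> closed_ideal Hplus_relators"
    unfolding avg_var_def fps_const_mult[symmetric] by (rule closed_ideal_mult_left)
  have "fps_const (poly_var v - traceless (poly_var v)) \<in> closed_ideal Hplus_relators"
    using avg by (cases "i = j") (simp_all add: v traceless_var closed_ideal_0)
  \<comment> \<open>With primes for normal forms, this is v p - v' p' = (v - v') p' + v (p -
    p').\<close>
  then have "fps_const (poly_var v - traceless (poly_var v)) * fps_const (traceless p) +
      fps_const (poly_var v) * fps_const (p - traceless p) \<in> closed_ideal Hplus_relators"
    using var_mult by (intro closed_ideal_add closed_ideal_mult_left closed_ideal_mult_right)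
  also have "fps_const (poly_var v - traceless (poly_var v)) * fps_const (traceless p) +
      fps_const (poly_var v) * fps_const (p - traceless p) =
      fps_const (poly_var v * p - traceless (poly_var v * p))"
    by (simp add: traceless_hom algebra_simps)
  finally show ?case .
qed

text \<open>The right side is the kernel of a ring homomorphism, closed because membership is tested
  degree by degree, and it contains the relators. Conversely, a coefficient p with normal form 0
  equals p minus its normal form and so lies in the ideal.\<close>

lemma closed_ideal_Hplus_relators:
  "closed_ideal Hplus_relators = {f. \<forall>n. traceless (fps_nth f n) = (0 :: 'n::finite x_poly)}"
proof
  show "closed_ideal Hplus_relators \<subseteq> {f. \<forall>n. traceless (fps_nth f n) = (0 :: 'n x_poly)}"
  proof (rule closed_ideal_least)
    show "two_sided_ideal {f. \<forall>n. traceless (fps_nth f n) = (0 :: 'n x_poly)}"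
      by (auto simp: two_sided_ideal_def traceless_add traceless_mult traceless_0 traceless_sum fps_mult_nth intro!: sum.neutral)
    show "closed {f. \<forall>n. traceless (fps_nth f n) = (0 :: 'n x_poly)}"
      unfolding closed_fps_iff mem_Collect_eq
    proof (intro allI impI)
      fix f :: "'n x_poly fps" and n
      assume "\<forall>n. \<exists>g\<in>{f. \<forall>n. traceless (fps_nth f n) = 0}. \<forall>j\<le>n. fps_nth g j = fps_nth f j"
      then obtain g where "\<forall>n. traceless (fps_nth g n) = 0" "\<forall>j\<le>n. fps_nth g j = fps_nth f j"
        by blast
      then show "traceless (fps_nth f n) = 0" by (metis order_refl)
    qed
    have "traceless (fps_nth (\<Sum>i\<in>UNIV. x_var i i k) n) = (0 :: 'n x_poly)" for k n
    proof -
      have "fps_nth (\<Sum>i\<in>UNIV. x_var i i k) n =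
          (if n = 0 then \<Sum>i\<in>UNIV. poly_var (i, i, k) else (0 :: 'n x_poly))"
        by (simp add: fps_sum_nth x_var_def poly_var_def)
      then show ?thesis
        using traceless_sum_diag[of k, where 'n = 'n] by (simp only: traceless_hom simp_thms split: if_split)
    qed
    then show "Hplus_relators \<subseteq> {f. \<forall>n. traceless (fps_nth f n) = (0 :: 'n x_poly)}"
      unfolding Hplus_relators_def by auto
  qed
next
  show "{f. \<forall>n. traceless (fps_nth f n) = (0 :: 'n x_poly)} \<subseteq> closed_ideal Hplus_relators"
  proof safe
    fix f assume f: "\<forall>n. traceless (fps_nth f n) = (0 :: 'n x_poly)"
    show "f \<in> closed_ideal Hplus_relators"
    proof (rule closed_ideal_coefficientwise)
      fix n show "fps_const (fps_nth f n) \<in> closed_ideal Hplus_relators"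
        using diff_traceless_in_ideal[of "fps_nth f n"] f by simp
    qed
  qed
qed

section \<open>Coordinates of a class: the coefficients of its normal form\<close>

lift_definition hcoef :: "nat \<Rightarrow> 'n::finite Hplus \<Rightarrow> 'n x_poly" is "\<lambda>n f. traceless (fps_nth f n)"
  by (simp add: closed_ideal_Hplus_relators traceless_hom)

lemma hcoef_abs: "hcoef n (abs_Hplus f) = traceless (fps_nth f n)"
  by (rule hcoef.abs_eq)

lemma abs_Hplus_rep: "abs_Hplus (rep_Hplus w) = w"
  by (rule Quotient3_abs_rep[OF Quotient3_Hplus])

lemma Hplus_eqI: "(\<And>n. hcoef n v = hcoef n w) \<Longrightarrow> v = w"
  by transfer (simp add: closed_ideal_Hplus_relators traceless_hom)

lemma traceless_hcoef [simp]: "traceless (hcoef n w) = hcoef n w"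
  by transfer (simp add: traceless_idem)

lemmas abs_Hplus_add = plus_Hplus.abs_eq[symmetric]
lemmas abs_Hplus_mult = times_Hplus.abs_eq[symmetric]
lemmas abs_Hplus_0 = zero_Hplus.abs_eq[symmetric]
lemmas abs_Hplus_1 = one_Hplus.abs_eq[symmetric]

lemma hcoef_add [simp]: "hcoef n (v + w) = hcoef n v + hcoef n w"
  by transfer (simp add: traceless_hom)

lemma hcoef_diff [simp]: "hcoef n (v - w) = hcoef n v - hcoef n w"
  by transfer (simp add: traceless_hom)

lemma hcoef_0 [simp]: "hcoef n 0 = 0"
  by transfer (simp add: traceless_hom)

lemma hcoef_mult: "hcoef n (v * w) = (\<Sum>i\<le>n. hcoef i v * hcoef (n - i) w)"
proof -
  obtain f g where "v = abs_Hplus f" "w = abs_Hplus g"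
    by (metis abs_Hplus_rep)
  then show ?thesis
    by (simp add: abs_Hplus_mult[symmetric] hcoef_abs fps_mult_nth traceless_hom atLeast0AtMost)
qed

lemma hcoef_1: "hcoef n 1 = (if n = 0 then 1 else 0)"
  by (simp add: abs_Hplus_1[symmetric] hcoef_abs traceless_hom traceless_1)

lemma Hplus_scalar_eq:
  "Hplus_scalar f = abs_Hplus (Abs_fps (\<lambda>m. poly_const (fps_nth f m)))"
  by (simp add: Hplus_scalar.abs_eq poly_const_def)

lemma hcoef_scale:
  "hcoef n (Hplus_scale f w) = (\<Sum>i\<le>n. poly_const (fps_nth f i) * hcoef (n - i) w)"
  by (simp add: Hplus_scale_def hcoef_mult Hplus_scalar_eq hcoef_abs traceless_hom)

lemma poly_const_sum: "poly_const (sum f I) = (\<Sum>i\<in>I. poly_const (f i))"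
  by (induction I rule: infinite_finite_induct) (simp_all add: poly_const_add)

lemma module_Hplus: "module Hplus_scale"
proof -
  have add: "Hplus_scalar (f + g) = Hplus_scalar f + Hplus_scalar g" for f g
    unfolding Hplus_scalar_eq abs_Hplus_add[symmetric]
    by (intro arg_cong[where f = abs_Hplus] fps_ext) (simp add: poly_const_add)
  have mult: "Hplus_scalar (f * g) = Hplus_scalar f * Hplus_scalar g" for f g
    unfolding Hplus_scalar_eq abs_Hplus_mult[symmetric]
    by (intro arg_cong[where f = abs_Hplus] fps_ext)
      (simp add: fps_mult_nth poly_const_sum poly_const_mult)
  have one: "Hplus_scalar 1 = 1"
    unfolding Hplus_scalar_eq abs_Hplus_1[symmetric]
    by (intro arg_cong[where f = abs_Hplus] fps_ext) simp
  show ?thesis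
    by unfold_locales
      (simp_all add: Hplus_scale_def add mult one distrib_left distrib_right mult.assoc)
qed

interpretation Hmod: module Hplus_scale
  by (rule module_Hplus)

lemma hcoef_X_pow_scale:
  "hcoef n (Hplus_scale (fps_X ^ m) w) = (if n < m then 0 else hcoef (n - m) w)"
  by (simp add: hcoef_scale if_distrib[of poly_const] if_distribR cong: if_cong)
    (simp add: if_distrib[of "\<lambda>x. x * _"] cong: if_cong)

lemma hcoef_X_scale:
  "hcoef n (Hplus_scale fps_X w) = (if n = 0 then 0 else hcoef (n - 1) w)"
  using hcoef_X_pow_scale[of n 1 w] by simp

lemma hcoef_const_scale: "hcoef n (Hplus_scale (fps_const a) w) = poly_const a * hcoef n w"
  by (simp add: hcoef_scale if_distrib[of poly_const] if_distrib[of "\<lambda>x. x * _"] cong: if_cong)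

lemma hcoef_sum: "hcoef n (sum f I) = (\<Sum>i\<in>I. hcoef n (f i))"
  by (induction I rule: infinite_finite_induct) simp_all

text \<open>Separatedness, in the form of a coinduction principle.\<close>

lemma h_divisible_imp_0:
  assumes step: "\<And>i. i \<in> I \<Longrightarrow> \<exists>j\<in>I. e i = Hplus_scale fps_X (e j)" and "i \<in> I"
  shows "e i = 0"
proof (rule Hplus_eqI)
  fix n
  have "hcoef n (e i) = 0"
    using \<open>i \<in> I\<close>
  proof (induction n arbitrary: i)
    case 0
    then show ?case using step[of i] by (auto simp: hcoef_X_scale)
  next
    case (Suc n)
    then show ?case using step[of i] by (auto simp: hcoef_X_scale)
  qed
  then show "hcoef n (e i) = hcoef n 0" by simp
qed

text \<open>\<open>hsum g\<close> is the convergent sum \<open>\<Sum>m. h\<^sup>m g\<^sub>m\<close>.\<close>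

definition hsum :: "(nat \<Rightarrow> 'n::finite Hplus) \<Rightarrow> 'n Hplus" where
  "hsum g = abs_Hplus (Abs_fps (\<lambda>n. \<Sum>m\<le>n. hcoef (n - m) (g m)))"

lemma hcoef_hsum: "hcoef n (hsum g) = (\<Sum>m\<le>n. hcoef (n - m) (g m))"
  by (simp add: hsum_def hcoef_abs traceless_hom)

lemma hsum_split: "hsum g = g 0 + Hplus_scale fps_X (hsum (\<lambda>m. g (Suc m)))"
proof (rule Hplus_eqI)
  fix n show "hcoef n (hsum g) = hcoef n (g 0 + Hplus_scale fps_X (hsum (\<lambda>m. g (Suc m))))"
    by (cases n) (simp_all add: hcoef_hsum hcoef_X_scale sum.atMost_Suc_shift del: sum.atMost_Suc)
qed

lemma hsum_add: "hsum (\<lambda>m. g m + g' m) = hsum g + hsum g'"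
  by (rule Hplus_eqI) (simp add: hcoef_hsum sum.distrib)

lemma hsum_0: "hsum (\<lambda>m. 0) = 0"
  by (rule Hplus_eqI) (simp add: hcoef_hsum)

lemma fps_split_X:
  fixes f :: "'b::ring_1 fps"
  shows "f = fps_const (fps_nth f 0) + fps_X * fps_shift 1 f"
  by (rule fps_ext) simp

text \<open>Splitting off the constant term of \<open>f\<close> on both sides shows that the defect
  for \<open>f\<close> is h times the defect for the shifted series, so it vanishes by
  separatedness. The same scheme recurs for linearity, continuity and multiplicativity.\<close>

lemma hsum_scale: "hsum (\<lambda>m. Hplus_scale (fps_const (fps_nth f m)) w) = Hplus_scale f w"
proof -
  let ?d = "\<lambda>f. hsum (\<lambda>m. Hplus_scale (fps_const (fps_nth f m)) w) - Hplus_scale f w"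
  have step: "?d f = Hplus_scale fps_X (?d (fps_shift 1 f))" for f
  proof -
    have "Hplus_scale f w = Hplus_scale (fps_const (fps_nth f 0)) w +
        Hplus_scale fps_X (Hplus_scale (fps_shift 1 f) w)"
      by (subst fps_split_X) (simp only: Hmod.scale_left_distrib Hmod.scale_scale)
    then show ?thesis
      by (subst hsum_split) (simp add: Hmod.scale_right_diff_distrib)
  qed
  have "?d f = 0"
    by (rule h_divisible_imp_0[of UNIV ?d]) (use step in blast)+
  then show ?thesis by simp
qed

lemma hsum_hcoef: "hsum (\<lambda>n. abs_Hplus (fps_const (hcoef n w))) = w"
proof (rule Hplus_eqI)
  fix n
  have "hcoef n (hsum (\<lambda>n. abs_Hplus (fps_const (hcoef n w)))) =
      (\<Sum>m\<le>n. if m = n then hcoef m w else 0)"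
    unfolding hcoef_hsum by (rule sum.cong) (auto simp: hcoef_abs traceless_hom)
  then show "hcoef n (hsum (\<lambda>n. abs_Hplus (fps_const (hcoef n w)))) = hcoef n w"
    by simp
qed

section \<open>Linear maps and their automatic continuity\<close>

definition Hlinear_on :: "'n::finite Hplus set \<Rightarrow> ('n Hplus \<Rightarrow> 'n Hplus) \<Rightarrow> bool" where
  "Hlinear_on W T \<longleftrightarrow>
     (\<forall>v\<in>W. \<forall>w\<in>W. T (v + w) = T v + T w) \<and>
     (\<forall>f. \<forall>w\<in>W. T (Hplus_scale f w) = Hplus_scale f (T w))"

text \<open>Closedness is phrased through convergent sums so that one induction over products of
  generators serves two targets: \<open>{0}\<close>, for equality of maps, and
  \<open>V_over K\<close>, for stability.\<close>

definition Hclosed :: "'n::finite Hplus set \<Rightarrow> bool" where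
  "Hclosed W \<longleftrightarrow> 0 \<in> W \<and>
     (\<forall>v\<in>W. \<forall>w\<in>W. v + w \<in> W) \<and> (\<forall>f. \<forall>w\<in>W. Hplus_scale f w \<in> W) \<and>
     (\<forall>g. (\<forall>m. g m \<in> W) \<longrightarrow> hsum g \<in> W)"

lemma Hclosed_UNIV: "Hclosed UNIV"
  by (simp add: Hclosed_def)

lemma Hclosed_0: "Hclosed {0}"
proof -
  have "hsum g = 0" if "\<forall>m. g m = 0" for g :: "nat \<Rightarrow> 'a Hplus"
  proof -
    from that have "g = (\<lambda>m. 0)" by auto
    then show ?thesis by (simp add: hsum_0)
  qed
  then show ?thesis by (simp add: Hclosed_def)
qed

lemma Hclosed_subspace: "Hclosed W \<Longrightarrow> Hmod.subspace W"
  by (auto simp: Hclosed_def Hmod.subspace_def)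

lemma Hclosed_diff: "Hclosed W \<Longrightarrow> v \<in> W \<Longrightarrow> w \<in> W \<Longrightarrow> v - w \<in> W"
  using Hmod.subspace_diff[OF Hclosed_subspace] by blast

lemma Hlinear_on_subset: "Hlinear_on W T \<Longrightarrow> W' \<subseteq> W \<Longrightarrow> Hlinear_on W' T"
  unfolding Hlinear_on_def by blast

text \<open>A scalar is a constant plus h times a scalar, so homogeneity for constants and for h
  leaves a defect that is infinitely divisible by h.\<close>

lemma Hlinear_onI:
  assumes W: "Hclosed W"
    and add: "\<And>v w. v \<in> W \<Longrightarrow> w \<in> W \<Longrightarrow> T (v + w) = T v + T w"
    and const: "\<And>a w. w \<in> W \<Longrightarrow> T (Hplus_scale (fps_const a) w) = Hplus_scale (fps_const a) (T w)"
    and X: "\<And>w. w \<in> W \<Longrightarrow> T (Hplus_scale fps_X w) = Hplus_scale fps_X (T w)"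
  shows "Hlinear_on W T"
  unfolding Hlinear_on_def
proof (intro conjI allI ballI)
  fix f w assume w: "w \<in> W"
  let ?d = "\<lambda>f. T (Hplus_scale f w) - Hplus_scale f (T w)"
  have step: "?d f = Hplus_scale fps_X (?d (fps_shift 1 f))" for f
  proof -
    have split: "Hplus_scale f u = Hplus_scale (fps_const (fps_nth f 0)) u +
        Hplus_scale fps_X (Hplus_scale (fps_shift 1 f) u)" for u :: "'a Hplus"
      by (subst fps_split_X) (simp only: Hmod.scale_left_distrib Hmod.scale_scale)
    have scale: "Hplus_scale g u \<in> W" if "u \<in> W" for g u
      using W that by (simp add: Hclosed_def)
    have "T (Hplus_scale f w) = Hplus_scale (fps_const (fps_nth f 0)) (T w) +
        Hplus_scale fps_X (T (Hplus_scale (fps_shift 1 f) w))"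
      by (subst split, subst add) (simp_all only: scale const X w)
    then show ?thesis
      by (simp add: split[of "T w"] Hmod.scale_right_diff_distrib)
  qed
  have "?d f = 0"
    by (rule h_divisible_imp_0[of UNIV ?d]) (use step in blast)+
  then show "T (Hplus_scale f w) = Hplus_scale f (T w)" by simp
qed (rule add)

lemma Hlinear_on_0: "Hlinear_on W T \<Longrightarrow> 0 \<in> W \<Longrightarrow> T 0 = 0"
  unfolding Hlinear_on_def by (metis Hmod.scale_zero_left)

text \<open>Peeling off \<open>g 0\<close> shows that the defect of \<open>g\<close> is h times the
  defect of the shifted sequence. Closedness of \<open>W\<close> keeps every tail sum in the domain
  of linearity.\<close>

lemma Hlinear_on_hsum:
  assumes W: "Hclosed W" and T: "Hlinear_on W T" and g: "\<And>m. g m \<in> W"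
  shows "T (hsum g) = hsum (\<lambda>m. T (g m))"
proof -
  let ?d = "\<lambda>g. T (hsum g) - hsum (\<lambda>m. T (g m))"
  let ?G = "{g. \<forall>m. g m \<in> W}"
  have step: "\<exists>g'\<in>?G. ?d g = Hplus_scale fps_X (?d g')" if "g \<in> ?G" for g
  proof (intro bexI[of _ "\<lambda>m. g (Suc m)"])
    have "hsum (\<lambda>m. g (Suc m)) \<in> W" "g 0 \<in> W"
      using W that by (auto simp: Hclosed_def)
    then have "T (hsum g) = T (g 0) + Hplus_scale fps_X (T (hsum (\<lambda>m. g (Suc m))))"
      using T W by (subst hsum_split) (simp add: Hlinear_on_def Hclosed_def)
    moreover have "hsum (\<lambda>m. T (g m)) = T (g 0) + Hplus_scale fps_X (hsum (\<lambda>m. T (g (Suc m))))"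
      by (rule hsum_split)
    ultimately show "?d g = Hplus_scale fps_X (?d (\<lambda>m. g (Suc m)))"
      by (simp add: Hmod.scale_right_diff_distrib)
  qed (use that in auto)
  have "?d g = 0"
    by (rule h_divisible_imp_0[of ?G ?d]) (use step g in auto)
  then show ?thesis by simp
qed

subsection \<open>Subalgebras of power series in a set of variables\<close>

text \<open>One family covers both modules: \<open>K = UNIV\<close> gives the whole algebra,
  \<open>K = diag_vars\<close> gives \<open>V_H\<close>.\<close>

definition V_over :: "('n \<times> 'n \<times> nat) set \<Rightarrow> 'n::finite Hplus set" where
  "V_over K = {w. \<forall>n. hcoef n w \<in> polys K}"

text \<open>The average that \<open>traceless\<close> subtracts involves all diagonal variables with
  the same third index, so this condition is what lets \<open>traceless\<close> preserve
  \<open>polys K\<close>.\<close>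

definition diag_complete :: "('n \<times> 'n \<times> nat) set \<Rightarrow> bool" where
  "diag_complete K \<longleftrightarrow> (\<forall>i j k. (i, i, k) \<in> K \<longrightarrow> (j, j, k) \<in> K)"

definition diag_vars :: "('n \<times> 'n \<times> nat) set" where
  "diag_vars = {(i, j, k). i = j}"

lemma diag_complete_UNIV: "diag_complete UNIV"
  and diag_complete_diag_vars: "diag_complete diag_vars"
  by (simp_all add: diag_complete_def diag_vars_def)

lemma V_over_UNIV: "V_over UNIV = UNIV"
  by (simp add: V_over_def polys_UNIV)

lemma Hclosed_V_over: "Hclosed (V_over K)"
proof -
  have "hsum g \<in> V_over K" if "\<forall>m. g m \<in> V_over K" for g
    using that by (auto simp: V_over_def hcoef_hsum intro!: polys_sum)
  then show ?thesis
    by (auto simp: Hclosed_def V_over_def hcoef_scale polys_0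
        intro!: polys.add polys_sum polys_mult polys.const)
qed

lemma mult_V_over: "v \<in> V_over K \<Longrightarrow> w \<in> V_over K \<Longrightarrow> v * w \<in> V_over K"
  by (auto simp: V_over_def hcoef_mult intro!: polys_sum polys_mult)

lemma one_V_over: "1 \<in> V_over K"
  using polys.const[of 1 K] by (auto simp: V_over_def hcoef_1 polys_0)

lemma traceless_polys:
  assumes "diag_complete K" "p \<in> polys K"
  shows "traceless p \<in> polys K"
  using assms(2)
proof induction
  case (var_mult v p)
  obtain i j k where v: "v = (i, j, k)" by (cases v)
  have "avg_var k \<in> polys K" if "i = j"
    using that assms(1) var_mult(1) v unfolding avg_var_def
    by (intro polys_mult polys.const polys_sum polys_var) (auto simp: diag_complete_def)
  then have "traceless (poly_var v) \<in> polys K"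
    using var_mult(1) by (auto simp: v traceless_var intro!: polys_diff polys_var polys_0)
  then show ?case
    using var_mult by (simp add: traceless_hom polys_mult)
qed (auto simp: traceless_hom intro: polys.const polys.add)

lemma abs_const_V_over:
  assumes "diag_complete K" "p \<in> polys K"
  shows "abs_Hplus (fps_const p) \<in> V_over K"
  using assms traceless_polys
  by (auto simp: V_over_def hcoef_abs traceless_hom polys_0)

lemma Hplus_x_eq: "Hplus_x i j k = abs_Hplus (fps_const (poly_var (i, j, k)))"
  by (simp add: Hplus_x.abs_eq x_var_def poly_var_def)

lemma Hplus_x_V_over: "diag_complete K \<Longrightarrow> (i, j, k) \<in> K \<Longrightarrow> Hplus_x i j k \<in> V_over K"
  by (simp add: Hplus_x_eq abs_const_V_over polys_var)

lemma abs_const_poly_const: "abs_Hplus (fps_const (poly_const a)) = Hplus_scalar (fps_const a)"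
  unfolding Hplus_scalar_eq by (intro arg_cong[where f = abs_Hplus] fps_ext) simp

text \<open>These are the coefficients of the tensor series at nonnegative exponents; testing linear
  maps on them makes the defining identities for tensor series directly applicable.\<close>

fun xprod :: "('n \<times> 'n \<times> nat) list \<Rightarrow> 'n::finite Hplus" where
  "xprod [] = 1"
| "xprod ((i, j, k) # vs) = Hplus_x i j k * xprod vs"

lemma xprod_V_over: "diag_complete K \<Longrightarrow> set vs \<subseteq> K \<Longrightarrow> xprod vs \<in> V_over K"
  by (induction vs rule: xprod.induct) (auto simp: one_V_over intro!: mult_V_over Hplus_x_V_over)

text \<open>Every element is a convergent h-series of complex combinations of products of
  generators, and \<open>T\<close> commutes with such series.\<close>

lemma Hlinear_on_V_over_induct:
  assumes K: "diag_complete K" and T: "Hlinear_on (V_over K) T" and Q: "Hclosed Q"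
    and vs: "\<And>vs. set vs \<subseteq> K \<Longrightarrow> T (xprod vs) \<in> Q"
    and w: "w \<in> V_over K"
  shows "T w \<in> Q"
proof -
  \<comment> \<open>\<open>T\<close> need not be multiplicative, so a variable cannot be factored
    out of its value; the prefix \<open>xprod vs\<close> collects the variables already split off
    from \<open>p\<close>.\<close>
  have *: "T (xprod vs * abs_Hplus (fps_const p)) \<in> Q" if "p \<in> polys K" "set vs \<subseteq> K" for p vs
    using that
  proof (induction arbitrary: vs)
    case (const a)
    have "T (Hplus_scale (fps_const a) (xprod vs)) = Hplus_scale (fps_const a) (T (xprod vs))"
      using T xprod_V_over[OF K const] by (simp add: Hlinear_on_def)
    moreover have "Hplus_scale (fps_const a) (T (xprod vs)) \<in> Q"
      using Q vs[OF const] by (simp add: Hclosed_def)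
    ultimately show ?case
      by (simp add: abs_const_poly_const Hplus_scale_def mult.commute)
  next
    case (add p q)
    have "xprod vs * abs_Hplus (fps_const (p + q)) =
        xprod vs * abs_Hplus (fps_const p) + xprod vs * abs_Hplus (fps_const q)"
      by (simp add: abs_Hplus_add[symmetric] distrib_left[symmetric])
    moreover have "xprod vs * abs_Hplus (fps_const r) \<in> V_over K" if "r \<in> polys K" for r
      using that K add by (intro mult_V_over xprod_V_over abs_const_V_over)
    ultimately show ?case
      using T Q add by (simp add: Hlinear_on_def Hclosed_def)
  next
    case (var_mult v p)
    obtain i j k where v: "v = (i, j, k)" by (cases v)
    have "xprod vs * abs_Hplus (fps_const (poly_var v * p)) =
        xprod (v # vs) * abs_Hplus (fps_const p)"
      by (simp add: v Hplus_x_eq abs_Hplus_mult mult_ac flip: fps_const_mult)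
    then show ?case
      using var_mult.IH[of "v # vs"] var_mult by simp
  qed
  have "T (hsum (\<lambda>n. abs_Hplus (fps_const (hcoef n w)))) =
      hsum (\<lambda>n. T (abs_Hplus (fps_const (hcoef n w))))"
    using w by (intro Hlinear_on_hsum[OF Hclosed_V_over T] abs_const_V_over[OF K])
      (auto simp: V_over_def)
  moreover have "T (abs_Hplus (fps_const (hcoef n w))) \<in> Q" for n
    using *[of "hcoef n w" "[]"] w by (simp add: V_over_def)
  ultimately show ?thesis
    using Q by (simp add: hsum_hcoef Hclosed_def)
qed

lemma Hlinear_on_eqI:
  assumes K: "diag_complete K" and T: "Hlinear_on (V_over K) T" "Hlinear_on (V_over K) T'"
    and vs: "\<And>vs. set vs \<subseteq> K \<Longrightarrow> T (xprod vs) = T' (xprod vs)"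
    and w: "w \<in> V_over K"
  shows "T w = T' w"
proof -
  have "Hlinear_on (V_over K) (\<lambda>w. T w - T' w)"
    using T by (simp add: Hlinear_on_def Hmod.scale_right_diff_distrib)
  from Hlinear_on_V_over_induct[OF K this Hclosed_0 _ w] show ?thesis
    using vs by simp
qed

lemma mem_h_pow_V_over:
  assumes "diag_complete K"
  shows "w \<in> h_pow Hplus_scale (V_over K) m \<longleftrightarrow> w \<in> V_over K \<and> (\<forall>n<m. hcoef n w = 0)"
proof
  assume "w \<in> h_pow Hplus_scale (V_over K) m"
  then show "w \<in> V_over K \<and> (\<forall>n<m. hcoef n w = 0)"
    using Hclosed_V_over[of K] by (auto simp: h_pow_def hcoef_X_pow_scale Hclosed_def)
next
  assume w: "w \<in> V_over K \<and> (\<forall>n<m. hcoef n w = 0)"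
  \<comment> \<open>Dividing by h^m shifts the normal form down by m degrees.\<close>
  let ?u = "abs_Hplus (Abs_fps (\<lambda>n. hcoef (n + m) w))"
  have "w = Hplus_scale (fps_X ^ m) ?u"
    by (rule Hplus_eqI) (use w in \<open>simp add: hcoef_X_pow_scale hcoef_abs\<close>)
  moreover have "?u \<in> V_over K"
    using w by (simp add: V_over_def hcoef_abs)
  ultimately show "w \<in> h_pow Hplus_scale (V_over K) m"
    by (auto simp: h_pow_def)
qed

text \<open>A nonzero scalar is a power of h times a unit. The unit cancels, and multiplication by
  the power of h merely shifts the normal form.\<close>

lemma torsion_free_Hplus: "torsion_free Hplus_scale W"
  unfolding torsion_free_def
proof (intro allI ballI impI)
  fix f and w :: "'a Hplus"
  assume *: "Hplus_scale f w = 0"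
  show "f = 0 \<or> w = 0"
  proof (cases "f = 0")
    case False
    let ?u = "fps_shift (subdegree f) f"
    have "inverse ?u * f = inverse ?u * ?u * fps_X ^ subdegree f"
      by (subst (2) subdegree_decompose[of f]) (simp add: mult.assoc)
    also have "\<dots> = fps_X ^ subdegree f"
      using False by (subst inverse_mult_eq_1) auto
    finally have "Hplus_scale (fps_X ^ subdegree f) w = Hplus_scale (inverse ?u) (Hplus_scale f w)"
      by simp
    then have "hcoef (n + subdegree f) (Hplus_scale (fps_X ^ subdegree f) w) = 0" for n
      by (simp add: *)
    then have "w = 0"
      by (intro Hplus_eqI) (simp add: hcoef_X_pow_scale)
    then show ?thesis ..
  qed simp
qed

lemma topologically_free_V_over:
  assumes K: "diag_complete K"
  shows "topologically_free Hplus_scale (V_over K)"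
proof -
  note mem = mem_h_pow_V_over[OF K]
  have "h_separated Hplus_scale (V_over K)"
  proof -
    have "w = 0" if "\<forall>m. w \<in> h_pow Hplus_scale (V_over K) m" for w
      by (rule Hplus_eqI) (use that[unfolded mem] in auto)
    moreover have "0 \<in> h_pow Hplus_scale (V_over K) m" for m
      using Hclosed_V_over[of K] by (simp add: mem Hclosed_def)
    ultimately show ?thesis unfolding h_separated_def by blast
  qed
  moreover have "h_complete Hplus_scale (V_over K)"
    unfolding h_complete_def
  proof (intro allI impI)
    fix w :: "nat \<Rightarrow> 'a Hplus"
    assume w: "range w \<subseteq> V_over K"
      and "\<forall>m. \<exists>n0. \<forall>n\<ge>n0. \<forall>n'\<ge>n0. w n - w n' \<in> h_pow Hplus_scale (V_over K) m"
    then obtain N where N: "\<And>m n n'. n \<ge> N m \<Longrightarrow> n' \<ge> N m \<Longrightarrow> w n - w n' \<in> h_pow Hplus_scale (V_over K) m"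
      by metis
    \<comment> \<open>Congruence modulo h^(j+1) controls the coefficients up to degree j, so the
      j-th coefficient is constant from index \<open>N (Suc j)\<close> on.\<close>
    define l where "l = abs_Hplus (Abs_fps (\<lambda>j. hcoef j (w (N (Suc j)))))"
    have l: "l \<in> V_over K"
      using w by (auto simp: V_over_def l_def hcoef_abs)
    \<comment> \<open>The sum is a convenient common upper bound of the finitely many thresholds
      \<open>N (Suc j)\<close> with \<open>j < m\<close>.\<close>
    have "w n - l \<in> h_pow Hplus_scale (V_over K) m" if n: "n \<ge> (\<Sum>j\<le>m. N j)" for m n
      unfolding mem
    proof (intro conjI allI impI)
      show "w n - l \<in> V_over K"
        using w l by (intro Hclosed_diff[OF Hclosed_V_over]) auto
      fix j assume "j < m"
      then have "N (Suc j) \<le> (\<Sum>j\<le>m. N j)"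
        by (intro member_le_sum) auto
      then have "w n - w (N (Suc j)) \<in> h_pow Hplus_scale (V_over K) (Suc j)"
        using n by (intro N) auto
      then show "hcoef j (w n - l) = 0"
        by (simp add: mem l_def hcoef_abs)
    qed
    with l show "\<exists>l\<in>V_over K. \<forall>m. \<exists>n0. \<forall>n\<ge>n0. w n - l \<in> h_pow Hplus_scale (V_over K) m"
      by blast
  qed
  ultimately show ?thesis
    by (simp add: topologically_free_def module_Hplus torsion_free_Hplus
        Hclosed_subspace[OF Hclosed_V_over])
qed

text \<open>For the inclusion from right to left, a topologically free subalgebra \<open>A\<close>
  with the diagonal generators contains the h-truncations of any \<open>w\<close> in
  \<open>V_over diag_vars\<close>. Its completeness provides a limit in \<open>A\<close>, and
  comparing coefficients identifies the limit with \<open>w\<close>.\<close>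

lemma V_H_eq: "V_H = V_over diag_vars"
proof
  show "V_H \<subseteq> (V_over diag_vars :: 'a Hplus set)"
    unfolding V_H_def
  proof (rule Inter_lower, safe)
    show "Hplus_subalgebra (V_over diag_vars :: 'a Hplus set)"
      by (simp add: Hplus_subalgebra_def Hclosed_subspace Hclosed_V_over one_V_over mult_V_over)
    show "topologically_free Hplus_scale (V_over diag_vars :: 'a Hplus set)"
      by (rule topologically_free_V_over[OF diag_complete_diag_vars])
    show "Hplus_x i i k \<in> V_over diag_vars" for i :: 'a and k
      by (rule Hplus_x_V_over[OF diag_complete_diag_vars]) (simp add: diag_vars_def)
  qed
next
  have "w \<in> A" if w: "w \<in> V_over diag_vars" and sub: "Hplus_subalgebra A"
    and free: "topologically_free Hplus_scale A" and gen: "\<forall>i k. Hplus_x i i k \<in> A"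
  for w :: "'a Hplus" and A
  proof -
    have A: "Hmod.subspace A" using sub by (simp add: Hplus_subalgebra_def)
    have const: "abs_Hplus (fps_const p) \<in> A" if "p \<in> polys diag_vars" for p
      using that
    proof induction
      case (const a)
      have "Hplus_scale (fps_const a) 1 \<in> A"
        using sub by (simp add: Hplus_subalgebra_def Hmod.subspace_scale)
      then show ?case by (simp add: abs_const_poly_const Hplus_scale_def)
    next
      case (add p q)
      then have "abs_Hplus (fps_const p) + abs_Hplus (fps_const q) \<in> A"
        using A by (simp add: Hmod.subspace_add)
      then show ?case by (simp add: abs_Hplus_add[symmetric])
    next
      case (var_mult v p)
      then obtain i k where v: "v = (i, i, k)" by (auto simp: diag_vars_def)
      have "Hplus_x i i k * abs_Hplus (fps_const p) \<in> A"
        using sub gen var_mult by (simp add: Hplus_subalgebra_def)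
      then show ?case by (simp add: v Hplus_x_eq abs_Hplus_mult[symmetric])
    qed
    define s where "s n = (\<Sum>m<n. Hplus_scale (fps_X ^ m) (abs_Hplus (fps_const (hcoef m w))))" for n
    have s_A: "s n \<in> A" for n
      unfolding s_def using w
      by (intro Hmod.subspace_sum[OF A] Hmod.subspace_scale[OF A] const) (simp add: V_over_def)
    have hcoef_s: "hcoef j (s n) = (if j < n then hcoef j w else 0)" for j n
    proof -
      have "hcoef j (s n) = (\<Sum>m<n. if m = j then hcoef j w else 0)"
        unfolding s_def hcoef_sum
        by (rule sum.cong) (auto simp: hcoef_X_pow_scale hcoef_abs traceless_hom)
      then show ?thesis by simp
    qed
    have pow: "Hmod.subspace (h_pow Hplus_scale A m)" for m
      unfolding h_pow_def Hmod.subspace_def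
    proof (intro conjI ballI allI)
      show "0 \<in> Hplus_scale (fps_X ^ m) ` A"
        by (rule image_eqI[of _ _ 0]) (simp_all add: Hmod.subspace_0[OF A])
    next
      fix x y assume "x \<in> Hplus_scale (fps_X ^ m) ` A" "y \<in> Hplus_scale (fps_X ^ m) ` A"
      then obtain u v where "u \<in> A" "v \<in> A"
        "x + y = Hplus_scale (fps_X ^ m) u + Hplus_scale (fps_X ^ m) v"
        by blast
      then show "x + y \<in> Hplus_scale (fps_X ^ m) ` A"
        using Hmod.subspace_add[OF A] by (metis Hmod.scale_right_distrib imageI)
    next
      fix c x assume "x \<in> Hplus_scale (fps_X ^ m) ` A"
      then obtain u where "u \<in> A" "x = Hplus_scale (fps_X ^ m) u"
        by blast
      then show "Hplus_scale c x \<in> Hplus_scale (fps_X ^ m) ` A"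
        using Hmod.subspace_scale[OF A] by (metis Hmod.scale_left_commute imageI)
    qed
    \<comment> \<open>Completeness of \<open>A\<close> refers to h^m A, so the differences have to
      be divisible by h^m inside \<open>A\<close> and not only in the ambient algebra.\<close>
    have tail: "s n - s m \<in> h_pow Hplus_scale A m" if "n \<ge> m" for n m
      using that
    proof (induction n rule: dec_induct)
      case base
      then show ?case using Hmod.subspace_0[OF pow] by simp
    next
      case (step n)
      have "Hplus_scale (fps_X ^ n) (abs_Hplus (fps_const (hcoef n w))) =
          Hplus_scale (fps_X ^ m)
            (Hplus_scale (fps_X ^ (n - m)) (abs_Hplus (fps_const (hcoef n w))))"
        using step by (simp flip: power_add)
      moreover have "abs_Hplus (fps_const (hcoef n w)) \<in> A"
        using w by (intro const) (simp add: V_over_def)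
      ultimately have "Hplus_scale (fps_X ^ n) (abs_Hplus (fps_const (hcoef n w))) \<in> h_pow Hplus_scale A m"
        using Hmod.subspace_scale[OF A] unfolding h_pow_def by blast
      from Hmod.subspace_add[OF pow step.IH this] show ?case
        by (simp add: s_def algebra_simps)
    qed
    have "\<forall>m. \<exists>n0. \<forall>n\<ge>n0. \<forall>n'\<ge>n0. s n - s n' \<in> h_pow Hplus_scale A m"
    proof (intro allI exI impI)
      fix m n n' :: nat assume "m \<le> n" "m \<le> n'"
      from Hmod.subspace_diff[OF pow tail[OF this(1)] tail[OF this(2)]]
      show "s n - s n' \<in> h_pow Hplus_scale A m" by simp
    qed
    then obtain l where l: "l \<in> A" "\<forall>m. \<exists>n0. \<forall>n\<ge>n0. s n - l \<in> h_pow Hplus_scale A m"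
      using free s_A unfolding topologically_free_def h_complete_def
      by (metis (no_types, lifting) image_subset_iff)
    have "l = w"
    proof (rule Hplus_eqI)
      fix j
      obtain n0 where "\<forall>n\<ge>n0. s n - l \<in> h_pow Hplus_scale A (Suc j)"
        using l by blast
      \<comment> \<open>The index is past \<open>n0\<close>, so that the difference is divisible by
        h^(j+1), and past \<open>j\<close>, so that the truncation already carries the coefficient
        of degree j.\<close>
      then have "s (max n0 (Suc j)) - l \<in> h_pow Hplus_scale A (Suc j)" by simp
      then have "hcoef j (s (max n0 (Suc j)) - l) = 0"
        by (auto simp: h_pow_def hcoef_X_pow_scale simp del: hcoef_diff power_Suc)
      moreover have "j < max n0 (Suc j)" by auto
      ultimately show "hcoef j l = hcoef j w" by (simp only: hcoef_diff hcoef_s) simp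
    qed
    with l show ?thesis by simp
  qed
  then show "(V_over diag_vars :: 'a Hplus set) \<subseteq> V_H"
    unfolding V_H_def by blast
qed

subsection \<open>Extension of linear maps from polynomials\<close>

text \<open>\<open>F\<close> is applied to normal forms only, so every \<open>F\<close> yields a map
  on the quotient; compatibility with the relators enters only when values on other representatives
  are computed.\<close>

definition hext :: "('n x_poly \<Rightarrow> 'n Hplus) \<Rightarrow> 'n::finite Hplus \<Rightarrow> 'n Hplus" where
  "hext F w = hsum (\<lambda>n. F (hcoef n w))"

lemma Hlinear_hext:
  assumes add: "\<And>p q. F (p + q) = F p + F q"
    and const: "\<And>a p. F (poly_const a * p) = Hplus_scale (fps_const a) (F p)"
  shows "Hlinear_on UNIV (hext F)"
proof (rule Hlinear_onI[OF Hclosed_UNIV])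
  have F0: "F 0 = 0" using const[of 0] by simp
  show "hext F (v + w) = hext F v + hext F w" for v w
    by (simp add: hext_def add hsum_add)
  have "Hlinear_on UNIV (Hplus_scale (fps_const a) :: 'a Hplus \<Rightarrow> _)" for a
    by (simp add: Hlinear_on_def Hmod.scale_right_distrib mult.commute)
  from Hlinear_on_hsum[OF Hclosed_UNIV this]
  show "hext F (Hplus_scale (fps_const a) w) = Hplus_scale (fps_const a) (hext F w)" for a w
    by (simp add: hext_def hcoef_const_scale const)
  show "hext F (Hplus_scale fps_X w) = Hplus_scale fps_X (hext F w)" for w
    unfolding hext_def by (subst hsum_split) (simp add: hcoef_X_scale F0)
qed

lemma hext_const:
  assumes "F 0 = 0"
  shows "hext F (abs_Hplus (fps_const p)) = F (traceless p)"
proof -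
  have "hext F (abs_Hplus (fps_const p)) =
      F (traceless p) + Hplus_scale fps_X (hsum (\<lambda>n. 0))"
    unfolding hext_def by (subst hsum_split) (simp add: hcoef_abs traceless_hom assms)
  then show ?thesis by (simp add: hsum_0)
qed

section \<open>The series S\<close>

lemma perm_P_nth: "perm_P $ p $ r = (if r = prod.swap p then 1 else 0)"
proof -
  have "perm_P $ p $ r = (\<Sum>i\<in>UNIV. \<Sum>j\<in>UNIV. if i = fst p then
      (if j = fst r then if snd p = fst r \<and> snd r = fst p then 1 else 0 else 0) else (0 :: 'a))"
    unfolding perm_P_def mat_tensor_def mat_unit_def sum_component
    by (intro sum.cong refl) auto
  also have "\<dots> = (\<Sum>i\<in>UNIV. if i = fst p then
      (\<Sum>j\<in>UNIV. if j = fst r then if snd p = fst r \<and> snd r = fst p then 1 else 0 else 0) else 0)"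
    by (intro sum.cong refl) auto
  finally show ?thesis
    by (cases p; cases r) auto
qed

lemma mat_mult_nth: "(mat g ** M) $ p $ r = g * M $ p $ r"
  by (simp add: matrix_matrix_mult_def mat_def if_distrib[of "\<lambda>x. x * _"] cong: if_cong)

lemma R_mat_nth:
  "R_mat q $ p $ r = (if p = r then 1 else 0) - q * (if r = prod.swap p then 1 else 0)"
  by (simp add: R_mat_def mat_mult_nth perm_P_nth) (simp add: mat_def)

text \<open>Since P^2 = I, the product is (1 + q q') I - (q + q') P.\<close>

lemma R_mat_mult_nth:
  "(R_mat q ** R_mat q') $ p $ r =
     (1 + q * q') * (if p = r then 1 else 0) - (q + q') * (if r = prod.swap p then 1 else 0)"
proof -
  have "(R_mat q ** R_mat q') $ p $ r =
      (\<Sum>s\<in>UNIV. (if s = p then R_mat q' $ s $ r else 0) -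
        q * (if s = prod.swap p then R_mat q' $ s $ r else 0))"
    unfolding matrix_matrix_mult_def vec_lambda_beta
    by (intro sum.cong refl) (simp add: R_mat_nth[of q] left_diff_distrib)
  also have "\<dots> = R_mat q' $ p $ r - q * R_mat q' $ prod.swap p $ r"
    by (simp add: sum_subtractf flip: sum_distrib_left)
  finally show ?thesis
    by (auto simp: R_mat_nth algebra_simps)
qed

lemma GRR_minus_I_nth:
  "GRR_minus_I g $ p $ r =
     (g * (1 + fps_X * h_over_shifted) - 1) * (if p = r then 1 else 0) -
     g * (fps_X + h_over_shifted) * (if r = prod.swap p then 1 else 0)"
  by (simp add: GRR_minus_I_def matrix_mul_assoc[symmetric] mat_mult_nth R_mat_mult_nth)
    (simp add: mat_def algebra_simps)

lemma sum_GRR_minus_I_1: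
  "(\<Sum>i\<in>UNIV. GRR_minus_I g $ (i, k) $ (i, l)) =
     (if k = l then g * (of_nat CARD('n) * (1 + fps_X * h_over_shifted) - (fps_X + h_over_shifted))
        - of_nat CARD('n) else 0)" for k l :: "'n::finite"
proof -
  have "(\<Sum>i\<in>UNIV. GRR_minus_I g $ (i, k) $ (i, l)) =
      (\<Sum>i\<in>UNIV. (g * (1 + fps_X * h_over_shifted) - 1) * (if k = l then 1 else 0) -
         (if i = k then g * (fps_X + h_over_shifted) * (if k = l then 1 else 0) else 0))"
    by (intro sum.cong) (auto simp: GRR_minus_I_nth)
  then show ?thesis
    unfolding sum_subtractf
    by (cases "k = l") (simp_all, simp add: algebra_simps)
qed

lemma sum_GRR_minus_I_2:
  "(\<Sum>i\<in>UNIV. GRR_minus_I g $ (k, i) $ (l, i)) = (\<Sum>i\<in>UNIV. GRR_minus_I g $ (i, k) $ (i, l))"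
  by (intro sum.cong) (auto simp: GRR_minus_I_nth)

text \<open>A partial trace sends P to I and the identity to N I, in either factor, so both trace
  conditions become one scalar equation g D = N. The constant term of D is N, hence D is invertible
  and g is unique.\<close>

lemma G_ser_eq:
  "G_ser TYPE('n::finite) *
     (of_nat CARD('n) * (1 + fps_X * h_over_shifted) - (fps_X + h_over_shifted)) = of_nat CARD('n)"
proof -
  define D :: "complex poly fps" where
    "D = of_nat CARD('n) * (1 + fps_X * h_over_shifted) - (fps_X + h_over_shifted)"
  have tr: "tr_1 (GRR_minus_I g :: _ ^ ('n \<times> 'n) ^ ('n \<times> 'n)) = 0 \<and>
      tr_2 (GRR_minus_I g :: _ ^ ('n \<times> 'n) ^ ('n \<times> 'n)) = 0 \<longleftrightarrow> g * D = of_nat CARD('n)" for g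
    unfolding tr_1_def tr_2_def vec_eq_iff sum_GRR_minus_I_2
    by (simp add: sum_GRR_minus_I_1 D_def)
  have D0: "fps_nth D 0 = of_nat CARD('n)"
    by (simp add: D_def h_over_shifted_def)
  have "D \<noteq> 0"
    using D0 by auto
  have "fps_nth D 0 * [:1 / of_nat CARD('n):] = 1"
    by (simp add: D0 of_nat_poly one_pCons)
  from fps_right_inverse[OF this] obtain D' where "D * D' = 1" by blast
  then have "(of_nat CARD('n) * D') * D = of_nat CARD('n)"
    by (simp add: mult.assoc mult.commute[of D'])
  moreover have "g = g'" if "g * D = of_nat CARD('n)" "g' * D = of_nat CARD('n)" for g g'
    using that \<open>D \<noteq> 0\<close> by (metis mult_right_cancel)
  ultimately have "\<exists>!g. g * D = of_nat CARD('n)"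
    by blast
  from theI'[OF this] show ?thesis
    unfolding G_ser_def tr D_def .
qed

text \<open>As h^2 S is a series in h/u alone, the coefficient of h^m in S is a single monomial in
  u^-1, of degree m + 2. The shift by 2 is the division by h^2.\<close>

definition S_coeff :: "'n::finite \<times> 'n \<Rightarrow> 'n \<times> 'n \<Rightarrow> nat \<Rightarrow> complex poly" where
  "S_coeff p r m = fps_nth (GRR_minus_I (G_ser TYPE('n)) $ p $ r) (m + 2)"

lemma sum_S_coeff_1: "(\<Sum>i\<in>UNIV. S_coeff (i, k) (i, l) m) = 0"
  and sum_S_coeff_2: "(\<Sum>i\<in>UNIV. S_coeff (k, i) (l, i) m) = 0"
  using G_ser_eq[where 'n = 'a]
  by (simp_all add: S_coeff_def sum_GRR_minus_I_1 sum_GRR_minus_I_2 flip: fps_sum_nth)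

text \<open>Only I and P enter, and their entry at (i, j), (i, j) depends only on whether i =
  j.\<close>

lemma S_coeff_sym: "S_coeff (i, j) (i, j) m = S_coeff (j, i) (j, i) m"
proof -
  have "((i, j) = prod.swap (i, j)) = ((j, i) = prod.swap (j, i))" by auto
  then show ?thesis
    by (simp only: S_coeff_def GRR_minus_I_nth simp_thms)
qed

lemma S_C_nth: "fps_nth (S_C $ p $ r) m = monom (S_coeff p r m) (m + 2)"
  by (simp add: S_C_def in_h_and_inv_u_def S_coeff_def)

definition S_exp :: "complex \<Rightarrow> 'n::finite \<times> 'n \<Rightarrow> 'n \<times> 'n \<Rightarrow> int \<Rightarrow> int \<Rightarrow> complex fps" where
  "S_exp c p r a b = expand_diff (S_at c $ p $ r) a b"

lemma S_exp_nth:
  "fps_nth (S_exp c p r a b) m =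
     (if b \<ge> 0 \<and> a + b = - int m - 2
      then poly (S_coeff p r m) c * of_nat (nat (- a - 1) choose nat b) else 0)"
  by (auto simp: S_exp_def expand_diff_def S_at_def S_C_nth map_poly_monom)

lemma s_C_exp_nth:
  "fps_nth (expand_diff (s_C i j) a b) m =
     (if b \<ge> 0 \<and> a + b = - int m - 2
      then S_coeff (i, j) (i, j) m * of_nat (nat (- a - 1) choose nat b) else 0)"
  by (auto simp: s_C_def expand_diff_def S_C_nth)

lemma poly_s_C_exp:
  "Abs_fps (\<lambda>m. poly (fps_nth (expand_diff (s_C i j) a b) m) c) = S_exp c (i, j) (i, j) a b"
  by (rule fps_ext) (simp add: S_exp_nth s_C_exp_nth)

lemma sum_S_exp_1: "(\<Sum>i\<in>UNIV. S_exp c (i, k) (i, l) a b) = 0"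
proof (rule fps_ext)
  show "fps_nth (\<Sum>i\<in>UNIV. S_exp c (i, k) (i, l) a b) m = fps_nth 0 m" for m
    by (cases "b \<ge> 0 \<and> a + b = - int m - 2")
      (auto simp: fps_sum_nth S_exp_nth sum_S_coeff_1 simp flip: sum_distrib_right poly_sum)
qed

lemma sum_S_exp_2: "(\<Sum>i\<in>UNIV. S_exp c (k, i) (l, i) a b) = 0"
proof (rule fps_ext)
  show "fps_nth (\<Sum>i\<in>UNIV. S_exp c (k, i) (l, i) a b) m = fps_nth 0 m" for m
    by (cases "b \<ge> 0 \<and> a + b = - int m - 2")
      (auto simp: fps_sum_nth S_exp_nth sum_S_coeff_2 simp flip: sum_distrib_right poly_sum)
qed

lemma S_exp_sym: "S_exp c (i, j) (i, j) a b = S_exp c (j, i) (j, i) a b"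
  by (rule fps_ext) (simp add: S_exp_nth S_coeff_sym[of i j])

lemma S_exp_eq_0: "b < 0 \<or> a \<ge> 0 \<Longrightarrow> S_exp c p r a b = 0"
  by (rule fps_ext) (auto simp: S_exp_nth)

section \<open>The operators x\<close>

definition hder :: "('n \<times> 'n \<times> nat \<Rightarrow> complex fps) \<Rightarrow> 'n::finite Hplus \<Rightarrow> 'n Hplus" where
  "hder d = hext (\<lambda>p. abs_Hplus (derivation d p))"

lemma derivation_0: "derivation d 0 = 0"
  using derivation_const[of d 0] by simp

lemma derivation_diff: "derivation d (p - q) = derivation d p - derivation d q"
  using derivation_add[of d "p - q" q] by simp

lemma derivation_sum: "derivation d (sum f I) = (\<Sum>i\<in>I. derivation d (f i))"
  by (induction I rule: infinite_finite_induct) (simp_all add: derivation_0 derivation_add)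

lemma Hlinear_hder: "Hlinear_on UNIV (hder d)"
  unfolding hder_def
proof (rule Hlinear_hext)
  show "abs_Hplus (derivation d (poly_const a * p)) =
      Hplus_scale (fps_const a) (abs_Hplus (derivation d p))" for a p
    by (simp add: derivation_mult derivation_const abs_Hplus_mult abs_const_poly_const
        Hplus_scale_def)
qed (simp add: derivation_add abs_Hplus_add)

lemma hder_add: "hder d (v + w) = hder d v + hder d w"
  and hder_scale: "hder d (Hplus_scale f w) = Hplus_scale f (hder d w)"
  using Hlinear_hder[of d] by (simp_all add: Hlinear_on_def)

lemma hder_0: "hder d 0 = 0"
  using hder_scale[of d 0 0] by simp

lemma hder_const: "hder d (abs_Hplus (fps_const p)) = abs_Hplus (derivation d (traceless p))"
  unfolding hder_def by (rule hext_const) (simp add: derivation_0 abs_Hplus_0)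

lemma hder_1: "hder d 1 = 0"
  using hder_const[of d 1] derivation_const[of d 1] by (simp add: traceless_1 abs_Hplus_0 abs_Hplus_1)

lemma Hlinear_on_comp: "Hlinear_on UNIV T \<Longrightarrow> Hlinear_on UNIV T' \<Longrightarrow> Hlinear_on UNIV (\<lambda>w. T (T' w))"
  by (simp add: Hlinear_on_def)

lemma Hlinear_on_add: "Hlinear_on W T \<Longrightarrow> Hlinear_on W T' \<Longrightarrow> Hlinear_on W (\<lambda>w. T w + T' w)"
  by (simp add: Hlinear_on_def Hmod.scale_right_distrib)

lemma Hlinear_mult: "Hlinear_on UNIV ((*) v)"
  by (simp add: Hlinear_on_def distrib_left Hplus_scale_def mult.left_commute)

lemma Hlinear_scale: "Hlinear_on UNIV (Hplus_scale f)"
  by (simp add: Hlinear_on_def Hmod.scale_right_distrib mult.commute)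

lemma Hlinear_UNIV_eqI:
  assumes "Hlinear_on UNIV T" "Hlinear_on UNIV T'" "\<And>vs. T (xprod vs) = T' (xprod vs)"
  shows "T w = T' w"
  using Hlinear_on_eqI[OF diag_complete_UNIV, of T T'] assms by (simp add: V_over_UNIV)

lemma xprod_const: "\<exists>p. xprod vs = abs_Hplus (fps_const p)"
proof (induction vs rule: xprod.induct)
  case 1
  show ?case using abs_Hplus_1 by (metis fps_const_1_eq_1 xprod.simps(1))
next
  case (2 i j k vs)
  then show ?case by (metis xprod.simps(2) Hplus_x_eq abs_Hplus_mult fps_const_mult)
qed

context
  fixes d :: "'n::finite \<times> 'n \<times> nat \<Rightarrow> complex fps"
  assumes d: "\<And>k. (\<Sum>l\<in>UNIV. d (l, l, k)) = 0"
begin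

text \<open>Passing to the normal form subtracts the average from a diagonal variable. The trace
  condition on \<open>d\<close> makes the derivative of the average vanish, so the generator keeps
  the value prescribed by \<open>d\<close>.\<close>

lemma hder_Hplus_x_mult:
  "hder d (Hplus_x i j k * w) = Hplus_scale (d (i, j, k)) w + Hplus_x i j k * hder d w"
proof (rule Hlinear_UNIV_eqI[where T = "\<lambda>w. hder d (Hplus_x i j k * w)"
      and T' = "\<lambda>w. Hplus_scale (d (i, j, k)) w + Hplus_x i j k * hder d w"])
  show "Hlinear_on UNIV (\<lambda>w. hder d (Hplus_x i j k * w))"
    by (rule Hlinear_on_comp[OF Hlinear_hder Hlinear_mult])
  show "Hlinear_on UNIV (\<lambda>w. Hplus_scale (d (i, j, k)) w + Hplus_x i j k * hder d w)"
    by (rule Hlinear_on_add[OF Hlinear_scale Hlinear_on_comp[OF Hlinear_mult Hlinear_hder]])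
  fix vs :: "('n \<times> 'n \<times> nat) list"
  obtain p where p: "xprod vs = abs_Hplus (fps_const p)"
    using xprod_const by blast
  let ?e = "\<lambda>v. Abs_fps (\<lambda>m. poly_const (fps_nth (d v) m)) :: 'n x_poly fps"
  have "(\<Sum>l\<in>UNIV. ?e (l, l, k)) = 0"
  proof (rule fps_ext)
    fix m
    have "fps_nth (\<Sum>l\<in>UNIV. d (l, l, k)) m = 0" using d by simp
    then show "fps_nth (\<Sum>l\<in>UNIV. ?e (l, l, k)) m = fps_nth 0 m"
      by (simp add: fps_sum_nth flip: poly_const_sum)
  qed
  then have "derivation d (avg_var k) = 0"
    unfolding avg_var_def derivation_mult derivation_sum derivation_var derivation_const by simp
  then have var: "derivation d (traceless (poly_var (i, j, k))) = ?e (i, j, k)"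
    by (simp add: traceless_var derivation_diff derivation_var derivation_0)
  have tr: "abs_Hplus (fps_const (traceless q)) = abs_Hplus (fps_const q)" for q :: "'n x_poly"
    by (rule Hplus_eqI) (simp add: hcoef_abs traceless_idem)
  have "hder d (Hplus_x i j k * xprod vs) =
      abs_Hplus (derivation d (traceless (poly_var (i, j, k) * p)))"
    by (simp add: p Hplus_x_eq hder_const abs_Hplus_mult[symmetric])
  also have "\<dots> = abs_Hplus (?e (i, j, k)) * abs_Hplus (fps_const p) +
      abs_Hplus (fps_const (poly_var (i, j, k))) * abs_Hplus (derivation d (traceless p))"
    unfolding traceless_hom derivation_mult var abs_Hplus_add abs_Hplus_mult tr ..
  finally show "hder d (Hplus_x i j k * xprod vs) =
      Hplus_scale (d (i, j, k)) (xprod vs) + Hplus_x i j k * hder d (xprod vs)"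
    by (simp add: p Hplus_x_eq hder_const Hplus_scale_def Hplus_scalar_eq)
qed

text \<open>\<open>x_plus\<close> is zero at negative exponents, so \<open>e\<close> has to be zero
  there as well; then the Leibniz expansion holds for all integer exponents, as the tensor series
  require.\<close>

lemma hder_prod_list:
  fixes e :: "('n \<times> 'n) \<times> int \<Rightarrow> complex fps"
  defines "x \<equiv> \<lambda>z :: ('n \<times> 'n) \<times> int. x_plus (fst (fst z)) (snd (fst z)) (snd z)"
  assumes e: "\<And>z. e z = (if snd z \<ge> 0 then d (fst (fst z), snd (fst z), nat (snd z)) else 0)"
  shows "hder d (prod_list (map x zs)) =
    (\<Sum>j<length zs. Hplus_scale (e (zs ! j)) (prod_list (map x (nths zs (- {j})))))"
proof (induction zs)
  case Nil
  show ?case by (simp add: hder_1)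
next
  case (Cons z zs)
  have step: "hder d (x z * w) = Hplus_scale (e z) w + x z * hder d w" for w
    by (simp add: x_def e x_plus_def hder_Hplus_x_mult hder_0)
  have 0: "nths (z # zs) (- {0}) = zs"
    by (simp add: nths_Cons Compl_eq nths_all)
  have Suc: "nths (z # zs) (- {Suc j}) = z # nths zs (- {j})" for j
    by (simp add: nths_Cons Compl_eq)
  have "hder d (prod_list (map x (z # zs))) =
      Hplus_scale (e z) (prod_list (map x zs)) +
      (\<Sum>j<length zs. Hplus_scale (e (zs ! j)) (x z * prod_list (map x (nths zs (- {j})))))"
    by (simp add: step Cons sum_distrib_left Hplus_scale_def mult.left_commute)
  then show ?case
    by (simp add: sum.lessThan_Suc_shift 0 Suc del: sum.lessThan_Suc)
qed

end

lemma V_over_0: "0 \<in> V_over K"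
  and V_over_add: "v \<in> V_over K \<Longrightarrow> w \<in> V_over K \<Longrightarrow> v + w \<in> V_over K"
  and V_over_scale: "w \<in> V_over K \<Longrightarrow> Hplus_scale f w \<in> V_over K"
  using Hclosed_V_over[of K] by (simp_all add: Hclosed_def)

lemma mem_h_pow_UNIV: "w \<in> h_pow Hplus_scale UNIV m \<longleftrightarrow> (\<forall>n<m. hcoef n w = 0)"
  using mem_h_pow_V_over[OF diag_complete_UNIV, of w m] by (simp add: V_over_UNIV)

text \<open>An element may involve infinitely many variables, but modulo h^m only finitely many
  polynomial coefficients matter, and each contains finitely many variables. The induction on m
  splits off the coefficient of degree 0.\<close>

lemma hder_limit:
  fixes d :: "int \<Rightarrow> 'n::finite \<times> 'n \<times> nat \<Rightarrow> complex fps"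
  assumes tr: "\<And>r k. (\<Sum>l\<in>UNIV. d r (l, l, k)) = 0"
    and lim: "\<And>v m. \<exists>r0. \<forall>r\<ge>r0. \<forall>n<m. fps_nth (d r v) n = 0"
  shows "\<exists>r0. \<forall>r\<ge>r0. \<forall>n<m. hcoef n (hder (d r) w) = 0"
proof -
  have polys: "\<exists>r0. \<forall>r\<ge>r0. \<forall>n<m. hcoef n (hder (d r) (abs_Hplus (fps_const p))) = 0" for p m
    using polys_UNIV[of p]
  proof induction
    case (const a)
    have "hder (d r) (Hplus_scale (fps_const a) 1) = 0" for r
      by (simp add: hder_scale hder_1)
    then show ?case by (simp add: abs_const_poly_const Hplus_scale_def)
  next
    case (add p q)
    then obtain r1 r2 where
      "\<forall>r\<ge>r1. \<forall>n<m. hcoef n (hder (d r) (abs_Hplus (fps_const p))) = 0"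
      "\<forall>r\<ge>r2. \<forall>n<m. hcoef n (hder (d r) (abs_Hplus (fps_const q))) = 0" by blast
    then have "\<forall>r\<ge>max r1 r2. \<forall>n<m. hcoef n (hder (d r) (abs_Hplus (fps_const (p + q)))) = 0"
      by (simp add: abs_Hplus_add hder_add flip: fps_const_add)
    then show ?case ..
  next
    case (var_mult v p)
    obtain i j k where v: "v = (i, j, k)" by (cases v)
    obtain r1 r2 where r: "\<forall>r\<ge>r1. \<forall>n<m. fps_nth (d r v) n = 0"
      "\<forall>r\<ge>r2. \<forall>n<m. hcoef n (hder (d r) (abs_Hplus (fps_const p))) = 0"
      using lim var_mult by blast
    have "hder (d r) (abs_Hplus (fps_const (poly_var v * p))) =
        Hplus_scale (d r v) (abs_Hplus (fps_const p)) +
        Hplus_x i j k * hder (d r) (abs_Hplus (fps_const p))" for r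
      using hder_Hplus_x_mult[of "d r" i j k, OF tr]
      by (simp add: v Hplus_x_eq abs_Hplus_mult flip: fps_const_mult)
    then have "\<forall>r\<ge>max r1 r2. \<forall>n<m. hcoef n (hder (d r) (abs_Hplus (fps_const (poly_var v * p)))) = 0"
      using r by (simp add: hcoef_scale hcoef_mult)
    then show ?case ..
  qed
  show ?thesis
  proof (induction m arbitrary: w)
    case (Suc m)
    let ?p = "hcoef 0 w" and ?w' = "hsum (\<lambda>n. abs_Hplus (fps_const (hcoef (Suc n) w)))"
    have w: "w = abs_Hplus (fps_const ?p) + Hplus_scale fps_X ?w'"
      using hsum_split[of "\<lambda>n. abs_Hplus (fps_const (hcoef n w))"] by (simp add: hsum_hcoef)
    obtain r1 where r1: "\<forall>r\<ge>r1. \<forall>n<Suc m. hcoef n (hder (d r) (abs_Hplus (fps_const ?p))) = 0"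
      using polys by blast
    obtain r2 where r2: "\<forall>r\<ge>r2. \<forall>n<m. hcoef n (hder (d r) ?w') = 0"
      using Suc.IH by blast
    have "hcoef n (hder (d r) w) = 0" if "r \<ge> max r1 r2" "n < Suc m" for r n
      using r1 r2 that by (subst w) (auto simp: hder_add hder_scale hcoef_X_scale)
    then show ?case by blast
  qed simp
qed

lemma hder_zero: "hder (\<lambda>v. 0) w = 0"
proof (rule Hlinear_UNIV_eqI[OF Hlinear_hder, where T' = "\<lambda>w. 0"])
  show "Hlinear_on UNIV (\<lambda>w. 0 :: 'a Hplus)"
    by (simp add: Hlinear_on_def)
  show "hder (\<lambda>v. 0) (xprod vs) = 0" for vs :: "('a \<times> 'a \<times> nat) list"
    by (induction vs rule: xprod.induct) (simp_all add: hder_1 hder_Hplus_x_mult)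
qed

text \<open>On a product x w, both orders give x times the iterated derivative of w plus d(x) d'(w)
  + d'(x) d(w), because the scalars d(x) and d'(x) pass through the other derivation.\<close>

lemma hder_commute:
  assumes "\<And>k. (\<Sum>l\<in>UNIV. d (l, l, k)) = 0" "\<And>k. (\<Sum>l\<in>UNIV. d' (l, l, k)) = 0"
  shows "hder d (hder d' w) = hder d' (hder d w)"
proof (rule Hlinear_UNIV_eqI[OF Hlinear_on_comp[OF Hlinear_hder Hlinear_hder]
      Hlinear_on_comp[OF Hlinear_hder Hlinear_hder]])
  show "hder d (hder d' (xprod vs)) = hder d' (hder d (xprod vs))" for vs
    by (induction vs rule: xprod.induct)
      (simp_all add: hder_1 hder_0 hder_Hplus_x_mult assms hder_add hder_scale add_ac)
qed

lemma hder_V_over: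
  assumes "\<And>k. (\<Sum>l\<in>UNIV. d (l, l, k)) = 0" "diag_complete K" "w \<in> V_over K"
  shows "hder d w \<in> V_over K"
proof (rule Hlinear_on_V_over_induct[OF assms(2) _ Hclosed_V_over _ assms(3)])
  show "Hlinear_on (V_over K) (hder d)"
    using Hlinear_hder by (rule Hlinear_on_subset) simp
  show "hder d (xprod vs) \<in> V_over K" if "set vs \<subseteq> K" for vs
    using that
  proof (induction vs rule: xprod.induct)
    case 1
    show ?case by (simp add: hder_1 V_over_0)
  next
    case (2 i j k vs)
    have "Hplus_scale (d (i, j, k)) (xprod vs) \<in> V_over K"
      using xprod_V_over[OF assms(2), of vs] 2 by (simp add: V_over_scale)
    moreover have "Hplus_x i j k * hder d (xprod vs) \<in> V_over K"
      using 2 by (intro mult_V_over Hplus_x_V_over[OF assms(2)]) auto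
    ultimately show ?case
      by (simp add: hder_Hplus_x_mult assms(1) V_over_add)
  qed
qed

section \<open>The coefficients of x^- as derivations\<close>

definition S_delta :: "complex \<Rightarrow> 'n \<Rightarrow> 'n \<Rightarrow> int \<Rightarrow> 'n::finite \<times> 'n \<times> nat \<Rightarrow> complex fps" where
  "S_delta c i j a = (\<lambda>(l, l', k). - S_exp c (i, l) (j, l') a (int k))"

lemma S_delta_apply: "S_delta c i j a (l, l', k) = - S_exp c (i, l) (j, l') a (int k)"
  by (simp add: S_delta_def)

text \<open>The sum runs over the tensor factor of the generator, so this is tr_2 of S; it supplies
  the trace condition of the Leibniz rule above.\<close>

lemma S_delta_trace: "(\<Sum>l\<in>UNIV. S_delta c i j a (l, l, k)) = 0"
  by (simp add: S_delta_def sum_negf sum_S_exp_2)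

lemma prod_list_map_nth:
  fixes f :: "'b \<Rightarrow> 'c::comm_monoid_mult"
  shows "prod_list (map f zs) = (\<Prod>l<length zs. f (zs ! l))"
  by (induction zs) (simp_all add: prod.lessThan_Suc_shift del: prod.lessThan_Suc)

lemma x_plus_tensor_eq:
  "x_plus_tensor n ps ks =
     (if length ps = n \<and> length ks = n
      then prod_list (map (\<lambda>z. x_plus (fst (fst z)) (snd (fst z)) (snd z)) (zip ps ks)) else 0)"
  by (auto simp: x_plus_tensor_def prod_list_map_nth)

lemma zip_nths: "length xs = length ys \<Longrightarrow> zip (nths xs A) (nths ys A) = nths (zip xs ys) A"
  by (induction xs ys arbitrary: A rule: list_induct2) (simp_all add: nths_Cons)

lemma length_nths_Compl: "j < length xs \<Longrightarrow> length (nths xs (- {j})) = length xs - 1"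
proof -
  assume "j < length xs"
  have "{i. i < length xs \<and> i \<in> - {j}} = {..<length xs} - {j}" by auto
  with \<open>j < length xs\<close> show ?thesis by (simp add: length_nths)
qed

lemma nths_Cons_Compl: "nths (x # xs) (- {0, Suc l}) = nths xs (- {l})"
  by (simp add: nths_Cons Compl_eq)

lemma is_x_minus_hder:
  "is_x_minus c (\<lambda>i j w a. hder (S_delta c i j a) w :: 'n::finite Hplus)"
  unfolding is_x_minus_def
proof (intro conjI allI impI)
  let ?X = "\<lambda>i j w a. hder (S_delta c i j a) w :: 'n Hplus"
  show nonneg: "?X i j w k = 0" if "k \<ge> 0" for i j w k
  proof -
    have "S_delta c i j k = (\<lambda>v. 0)"
      using that by (auto simp: S_delta_def S_exp_eq_0)
    then show ?thesis by (simp add: hder_zero)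
  qed
  show "?X i j \<in> series_Hom Hplus_scale UNIV (inv_poly_h Hplus_scale UNIV)" for i j
  proof -
    have "\<exists>r0. \<forall>r\<ge>r0. ?X i j w (- r - 1) \<in> h_pow Hplus_scale UNIV m" for w m
    proof -
      have "\<exists>r0. \<forall>r\<ge>r0. \<forall>n<m. hcoef n (hder (S_delta c i j (- r - 1)) w) = 0"
      proof (rule hder_limit)
        fix v :: "'n \<times> 'n \<times> nat" and m
        obtain l l' k where v: "v = (l, l', k)" by (cases v)
        \<comment> \<open>At exponents -r-1 and k, S can contribute only in degree r - k - 1 of h,
          which is at least m for these r.\<close>
        have "\<forall>r\<ge>int m + int k + 1. \<forall>n<m. fps_nth (S_delta c i j (- r - 1) v) n = 0"
          by (auto simp: v S_delta_def S_exp_nth)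
        then show "\<exists>r0. \<forall>r\<ge>r0. \<forall>n<m. fps_nth (S_delta c i j (- r - 1) v) n = 0" ..
      qed (rule S_delta_trace)
      then show ?thesis
        by (simp add: mem_h_pow_UNIV)
    qed
    then show ?thesis
      by (simp add: series_Hom_def inv_poly_h_def laurent_h_def nonneg hder_add hder_scale)
  qed
  show "?X i j 1 k = 0" for i j k
    by (rule hder_1)
  show "apply_0 ?X (x_plus_tensor n) ps ks = - (\<Sum>j = 1..n. S_0j_tensor c n j ps ks)"
    if "n \<ge> 1" for n ps ks
  proof (cases "length ps = Suc n \<and> length ks = Suc n")
    case False
    have "S_0j_tensor c n j ps ks = 0" for j
      using False by (auto simp: S_0j_tensor_def)
    moreover have "apply_0 ?X (x_plus_tensor n) ps ks = 0"
      using False by (cases "(?X, x_plus_tensor n :: ('n, 'n Hplus) tensor_series, ps, ks)" rule: apply_0.cases)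
        (auto simp: x_plus_tensor_def hder_0)
    ultimately show ?thesis by simp
  next
    case True
    then obtain i j ps' k ks' where ps: "ps = (i, j) # ps'" "ks = k # ks'"
      and len: "length ps' = n" "length ks' = n"
      by (metis length_Suc_conv surj_pair)
    let ?x = "\<lambda>z :: ('n \<times> 'n) \<times> int. x_plus (fst (fst z)) (snd (fst z)) (snd z) :: 'n Hplus"
    let ?e = "\<lambda>z :: ('n \<times> 'n) \<times> int. - S_exp c (i, fst (fst z)) (j, snd (fst z)) k (snd z)"
    have "apply_0 ?X (x_plus_tensor n) ps ks =
        hder (S_delta c i j k) (prod_list (map ?x (zip ps' ks')))"
      using len by (simp add: ps x_plus_tensor_eq)
    also have "\<dots> = (\<Sum>l<n. Hplus_scale (?e (zip ps' ks' ! l))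
        (prod_list (map ?x (nths (zip ps' ks') (- {l})))))"
      using len by (subst hder_prod_list[where e = ?e])
        (auto simp: S_delta_apply S_exp_eq_0 sum_negf sum_S_exp_2)
    \<comment> \<open>Position l of the tails carries the label l + 1, since label 0 belongs to the
      operator.\<close>
    also have "\<dots> = (\<Sum>l<n. - S_0j_tensor c n (Suc l) ps ks)"
    proof (rule sum.cong)
      fix l assume "l \<in> {..<n}"
      then have l: "l < n" by simp
      have "x_plus_tensor (n - 1) (nths ps (- {0, Suc l})) (nths ks (- {0, Suc l})) =
          prod_list (map ?x (nths (zip ps' ks') (- {l})))"
        using len l by (simp add: ps x_plus_tensor_eq length_nths_Compl zip_nths nths_Cons_Compl)
      then show "Hplus_scale (?e (zip ps' ks' ! l)) (prod_list (map ?x (nths (zip ps' ks') (- {l})))) =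
          - S_0j_tensor c n (Suc l) ps ks"
        using len l by (simp add: S_0j_tensor_def ps S_exp_def)
    qed simp
    also have "\<dots> = - (\<Sum>j = 1..n. S_0j_tensor c n j ps ks)"
      by (simp add: sum_negf sum.atLeast1_atMost_eq)
    finally show ?thesis .
  qed
qed

lemma xprod_eq_x_plus_tensor:
  "xprod vs = x_plus_tensor (length vs) (map (\<lambda>(i, j, k). (i, j)) vs) (map (\<lambda>(i, j, k). int k) vs)"
  by (induction vs rule: xprod.induct) (simp_all add: x_plus_tensor_eq x_plus_def)

text \<open>Two solutions agree on all products of generators, hence everywhere by linearity. This
  is the uniqueness on which the description operator in \<open>x_minus\<close> relies.\<close>

lemma x_minus_eq: "x_minus c = (\<lambda>i j w a. hder (S_delta c i j a) w :: 'n::finite Hplus)"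
  unfolding x_minus_def
proof (rule the_equality[where P = "is_x_minus c", OF is_x_minus_hder])
  fix X :: "('n, 'n Hplus) op_series"
  assume X: "is_x_minus c X"
  let ?Y = "\<lambda>i j w a. hder (S_delta c i j a) w :: 'n Hplus"
  show "X = ?Y"
  proof (intro ext)
    fix i j w a
    show "X i j w a = ?Y i j w a"
    proof (rule Hlinear_UNIV_eqI[OF _ Hlinear_hder, where T = "\<lambda>w. X i j w a"])
      show "Hlinear_on UNIV (\<lambda>w. X i j w a)"
        using X by (auto simp: is_x_minus_def series_Hom_def Hlinear_on_def)
    next
      fix vs :: "('n \<times> 'n \<times> nat) list"
      let ?n = "length vs"
      let ?ps = "map (\<lambda>(i, j, k). (i, j)) vs" and ?ks = "map (\<lambda>(i, j, k). int k) vs"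
      show "X i j (xprod vs) a = ?Y i j (xprod vs) a"
      proof (cases "?n = 0")
        \<comment> \<open>The tensor identity starts at n = 1; the empty product is settled by the
          condition that x^- annihilates the unit.\<close>
        case True
        then show ?thesis using X by (simp add: is_x_minus_def hder_1)
      next
        case False
        then have n: "?n \<ge> 1" by (cases ?n) simp_all
        have "X' i j (xprod vs) a =
            - (\<Sum>l = 1..?n. S_0j_tensor c ?n l ((i, j) # ?ps) (a # ?ks))"
          if "is_x_minus c X'" for X' :: "('n, 'n Hplus) op_series"
        proof -
          have "X' i j (xprod vs) a = apply_0 X' (x_plus_tensor ?n) ((i, j) # ?ps) (a # ?ks)"
            by (simp add: xprod_eq_x_plus_tensor)
          also have "\<dots> = - (\<Sum>l = 1..?n. S_0j_tensor c ?n l ((i, j) # ?ps) (a # ?ks))"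
            using that n unfolding is_x_minus_def by blast
          finally show ?thesis .
        qed
        from this[OF X] this[OF is_x_minus_hder] show ?thesis by simp
      qed
    qed
  qed
qed

lemma x_minus_laurent: "x_minus c i j w \<in> inv_poly_h Hplus_scale UNIV"
  using is_x_minus_hder[of c] unfolding x_minus_eq is_x_minus_def series_Hom_def by blast

subsection \<open>The diagonal operators\<close>

definition y_coeff :: "complex \<Rightarrow> 'n::finite cartan fps \<Rightarrow> 'n \<Rightarrow> int \<Rightarrow> 'n Hplus \<Rightarrow> 'n Hplus" where
  "y_coeff c \<alpha> i k w = x_a_op c \<alpha> i i w k"

lemma y_coeff_eq:
  "y_coeff c \<alpha> i k w = x_plus i i k * w + hder (S_delta c i i k) w +
     Hplus_scale (if k = - 1 then a_mat \<alpha> $ i $ i else 0) w"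
  by (simp add: y_coeff_def x_a_op_def x_op_def x_minus_eq)

lemma Hlinear_y_coeff: "Hlinear_on UNIV (y_coeff c \<alpha> i k)"
  unfolding y_coeff_eq
  by (rule Hlinear_on_add[OF Hlinear_on_add[OF Hlinear_mult Hlinear_hder] Hlinear_scale])

lemma y_coeff_V_over:
  assumes "w \<in> V_over diag_vars"
  shows "y_coeff c \<alpha> i k w \<in> V_over diag_vars"
proof -
  have "x_plus i i k \<in> V_over diag_vars"
    using Hplus_x_V_over[OF diag_complete_diag_vars, of i i "nat k"]
    by (simp add: x_plus_def diag_vars_def V_over_0)
  then show ?thesis
    using assms hder_V_over[OF S_delta_trace diag_complete_diag_vars assms]
    by (simp add: y_coeff_eq mult_V_over V_over_add V_over_scale)
qed

lemma sum_x_plus_diag: "(\<Sum>i\<in>UNIV. x_plus i i k) = 0"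
proof (cases "k \<ge> 0")
  case True
  have "(\<Sum>i\<in>UNIV. Hplus_x i i (nat k)) = (0 :: 'a Hplus)"
  proof (rule Hplus_eqI)
    fix n
    show "hcoef n (\<Sum>i\<in>UNIV. Hplus_x i i (nat k)) = hcoef n (0 :: 'a Hplus)"
      using traceless_sum_diag[of "nat k", where 'n = 'a]
      by (cases n) (simp_all add: hcoef_sum Hplus_x_eq hcoef_abs traceless_hom)
  qed
  then show ?thesis using True by (simp add: x_plus_def)
qed (simp add: x_plus_def)

text \<open>Pairing with a_i gives the i-th coordinate of a representative minus the average of its
  coordinates, and these differences sum to zero.\<close>

lemma sum_cartan_form_a: "(\<Sum>i\<in>UNIV. cartan_form (cartan_a i) x) = 0"
proof transfer
  fix w :: "complex ^ 'a"
  have "(\<Sum>l\<in>UNIV. (axis i 1 :: complex ^ 'a) $ l * w $ l) = w $ i"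
    and "(\<Sum>l\<in>UNIV. (axis i 1 :: complex ^ 'a) $ l) = 1" for i
    by (simp_all add: axis_def if_distrib[of "\<lambda>x. x * _"] cong: if_cong)
  then show "(\<Sum>i\<in>UNIV. \<Sum>l\<in>UNIV. \<Sum>j\<in>UNIV.
      axis i 1 $ l * w $ j * ((if l = j then 1 else 0) - 1 / of_nat CARD('a))) = 0"
    unfolding sum_sum_delta_minus_inverse_card by (simp add: sum_subtractf)
qed

lemma sum_a_mat_diag: "(\<Sum>i\<in>UNIV. a_mat \<alpha> $ i $ i) = 0"
proof (rule fps_ext)
  fix n
  have "(\<Sum>i\<in>UNIV. \<Sum>k\<le>n. cartan_form (fps_nth (fps_const (cartan_a i)) k) (fps_nth \<alpha> (n - k))) =
      (\<Sum>k\<le>n. \<Sum>i\<in>UNIV. cartan_form (if k = 0 then cartan_a i else 0) (fps_nth \<alpha> (n - k)))"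
    by (subst sum.swap) simp
  also have "\<dots> = 0"
  proof (rule sum.neutral, safe)
    fix k
    have "cartan_form 0 x = 0" for x :: "'a cartan"
      by transfer simp
    then show "(\<Sum>i\<in>UNIV. cartan_form (if k = 0 then cartan_a i else 0) (fps_nth \<alpha> (n - k))) = 0"
      by (cases "k = 0") (simp_all add: sum_cartan_form_a)
  qed
  finally show "fps_nth (\<Sum>i\<in>UNIV. a_mat \<alpha> $ i $ i) n = fps_nth 0 n"
    by (simp add: fps_sum_nth a_mat_def cartan_form_h_def)
qed

text \<open>Here the trace is over the factor of the operator, so it is tr_1 of S that vanishes; on
  a product the Leibniz rule then contributes nothing.\<close>

lemma hder_sum_S_delta: "(\<Sum>i\<in>UNIV. hder (S_delta c i i k) w) = 0"
proof (rule Hlinear_UNIV_eqI[where T = "\<lambda>w. \<Sum>i\<in>UNIV. hder (S_delta c i i k) w" and T' = "\<lambda>w. 0"])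
  show "Hlinear_on UNIV (\<lambda>w. \<Sum>i\<in>UNIV. hder (S_delta c i i k) w)"
    by (simp add: Hlinear_on_def hder_add hder_scale sum.distrib Hmod.scale_sum_right)
  show "Hlinear_on UNIV (\<lambda>w. 0)"
    by (simp add: Hlinear_on_def)
  show "(\<Sum>i\<in>UNIV. hder (S_delta c i i k) (xprod vs)) = 0" for vs :: "('a \<times> 'a \<times> nat) list"
  proof (induction vs rule: xprod.induct)
    case (2 l l' k' vs)
    have "(\<Sum>i\<in>UNIV. S_delta c i i k (l, l', k')) = 0"
      by (simp add: S_delta_def sum_negf sum_S_exp_1)
    with 2 show ?case
      by (simp add: hder_Hplus_x_mult S_delta_trace sum.distrib
          flip: Hmod.scale_sum_left sum_distrib_left)
  qed (simp add: hder_1)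
qed

lemma sum_y_coeff: "(\<Sum>i\<in>UNIV. y_coeff c \<alpha> i k w) = 0"
proof -
  have "(\<Sum>i\<in>UNIV. Hplus_scale (if k = - 1 then a_mat \<alpha> $ i $ i else 0) w) = 0"
    by (cases "k = - 1") (simp_all add: sum_a_mat_diag flip: Hmod.scale_sum_left)
  moreover have "(\<Sum>i\<in>UNIV. x_plus i i k * w) = 0"
    by (simp add: sum_x_plus_diag flip: sum_distrib_right)
  ultimately show ?thesis
    by (simp add: y_coeff_eq sum.distrib hder_sum_S_delta)
qed

lemma hder_x_plus_mult:
  "hder (S_delta c i i a) (x_plus j j b * w) =
     x_plus j j b * hder (S_delta c i i a) w - Hplus_scale (S_exp c (i, j) (i, j) a b) w"
  by (auto simp: x_plus_def hder_Hplus_x_mult[OF S_delta_trace] hder_0 S_exp_eq_0 S_delta_apply)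

text \<open>Multiplications commute with each other, derivations do too, and the \<alpha> terms are
  scalars. A derivation moved past a multiplication leaves minus a coefficient of S, which the added
  scalar cancels; both sides then become the same product with the multiplications to the
  left.\<close>

lemma y_coeff_commute:
  "y_coeff c \<alpha> i a (y_coeff c \<alpha> j b w) + Hplus_scale (S_exp c (i, j) (i, j) a b) w =
   y_coeff c \<alpha> j b (y_coeff c \<alpha> i a w) + Hplus_scale (S_exp c (i, j) (i, j) b a) w"
proof -
  have mult_scale: "x * Hplus_scale f w = Hplus_scale f (x * w)"
    "Hplus_scale f w * x = Hplus_scale f (w * x)" for x w :: "'a Hplus" and f
    by (simp_all add: Hplus_scale_def mult_ac)
  have hder_mult: "hder (S_delta c l l r) (v * x_plus l' l' s) =
      x_plus l' l' s * hder (S_delta c l l r) v - Hplus_scale (S_exp c (l, l') (l, l') r s) v"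
    for l l' r s v
    by (subst mult.commute) (rule hder_x_plus_mult)
  show ?thesis
    by (simp add: y_coeff_eq hder_add hder_scale hder_x_plus_mult hder_mult mult_scale S_exp_sym[of c j i]
        Hmod.scale_right_distrib Hmod.scale_right_diff_distrib algebra_simps
        hder_commute[of "S_delta c i i a" "S_delta c j j b", OF S_delta_trace S_delta_trace])
qed

lemma y_coeff_laurent: "(\<lambda>k. y_coeff c \<alpha> i k w) \<in> laurent_h Hplus_scale V_H" if "w \<in> V_H"
  unfolding laurent_h_def
proof (safe)
  show "y_coeff c \<alpha> i k w \<in> V_H" for k
    using that y_coeff_V_over by (simp add: V_H_eq)
  fix m
  obtain r0 where r0: "\<forall>r\<ge>r0. x_minus c i i w (- r - 1) \<in> h_pow Hplus_scale UNIV m"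
    using x_minus_laurent[of c i i w] unfolding inv_poly_h_def laurent_h_def by blast
  have "y_coeff c \<alpha> i (- r - 1) w \<in> h_pow Hplus_scale V_H m" if r: "r \<ge> max r0 1" for r
  proof -
    \<comment> \<open>From r = 1 on, the exponent is at most -2, which excludes both the nonnegative
      exponents of x^+ and the \<alpha> term at exponent -1.\<close>
    have "y_coeff c \<alpha> i (- r - 1) w = x_minus c i i w (- r - 1)"
      using r by (simp add: y_coeff_def x_a_op_def x_op_def x_plus_def)
    moreover have "y_coeff c \<alpha> i (- r - 1) w \<in> V_over diag_vars"
      using that y_coeff_V_over \<open>w \<in> V_H\<close> by (simp add: V_H_eq)
    ultimately show ?thesis
      using r0 r by (simp add: V_H_eq mem_h_pow_UNIV mem_h_pow_V_over[OF diag_complete_diag_vars])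
  qed
  then show "\<exists>r0. \<forall>r\<ge>r0. y_coeff c \<alpha> i (- r - 1) w \<in> h_pow Hplus_scale V_H m"
    by blast
qed

section \<open>The action of H(C)\<close>

fun word_act :: "('g \<Rightarrow> 'n Hplus \<Rightarrow> 'n Hplus) \<Rightarrow> 'g list \<Rightarrow> 'n::finite Hplus \<Rightarrow> 'n Hplus" where
  "word_act G [] w = w"
| "word_act G (g # gs) w = G g (word_act G gs w)"

fun monoid_act ::
  "('g \<Rightarrow> 'n Hplus \<Rightarrow> 'n Hplus) \<Rightarrow> 'g free_monoid \<Rightarrow> 'n::finite Hplus \<Rightarrow> 'n Hplus" where
  "monoid_act G (Word gs) w = word_act G gs w"

definition free_act ::
  "('g \<Rightarrow> 'n Hplus \<Rightarrow> 'n Hplus) \<Rightarrow> ('g free_monoid \<Rightarrow>\<^sub>0 complex) \<Rightarrow> 'n::finite Hplus \<Rightarrow> 'n Hplus" where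
  "free_act G p w = linear_ext (\<lambda>m a. Hplus_scale (fps_const a) (monoid_act G m w)) p"

definition series_act ::
  "('g \<Rightarrow> 'n Hplus \<Rightarrow> 'n Hplus) \<Rightarrow> ('g free_monoid \<Rightarrow>\<^sub>0 complex) fps \<Rightarrow> 'n::finite Hplus \<Rightarrow> 'n Hplus" where
  "series_act G f w = hsum (\<lambda>m. free_act G (fps_nth f m) w)"

lemma free_act_add: "free_act G (p + q) w = free_act G p w + free_act G q w"
  unfolding free_act_def
  by (rule linear_ext_add) (simp_all add: Hmod.scale_left_distrib flip: fps_const_add)

lemma free_act_single:
  "free_act G (Poly_Mapping.single m a) w = Hplus_scale (fps_const a) (monoid_act G m w)"
  unfolding free_act_def by (rule linear_ext_single) simp

lemma free_act_0: "free_act G 0 w = 0"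
  by (simp add: free_act_def linear_ext_def)

lemma free_act_sum: "free_act G (sum f I) w = (\<Sum>i\<in>I. free_act G (f i) w)"
  by (induction I rule: infinite_finite_induct) (simp_all add: free_act_add free_act_0)

lemma free_act_scalar: "free_act G (Poly_Mapping.single 0 a) w = Hplus_scale (fps_const a) w"
  by (simp add: free_act_single zero_free_monoid_def)

lemma free_act_free_gen: "free_act G (free_gen g) w = G g w"
  by (simp add: free_gen_def free_act_single)

lemma series_act_split:
  "series_act G f w =
     free_act G (fps_nth f 0) w + Hplus_scale fps_X (series_act G (fps_shift 1 f) w)"
  unfolding series_act_def by (subst hsum_split) simp

lemma series_act_add: "series_act G (f + g) w = series_act G f w + series_act G g w"
  by (simp add: series_act_def free_act_add hsum_add)

lemma series_act_const: "series_act G (fps_const p) w = free_act G p w"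
  by (subst series_act_split) (simp add: series_act_def free_act_0 hsum_0)

lemma series_act_X_mult: "series_act G (fps_X * f) w = Hplus_scale fps_X (series_act G f w)"
proof -
  have "fps_shift 1 (fps_X * f) = f"
    by (rule fps_ext) simp
  then show ?thesis
    by (subst series_act_split) (simp add: free_act_0)
qed

lemma series_act_0: "series_act G 0 w = 0"
  by (simp add: series_act_def free_act_0 hsum_0)

lemma series_act_scalar:
  "series_act G (Abs_fps (\<lambda>m. Poly_Mapping.single 0 (fps_nth f m))) w = Hplus_scale f w"
  by (simp add: series_act_def free_act_scalar hsum_scale)

lemma hcoef_series_act_cong:
  assumes "\<forall>j\<le>n. fps_nth f j = fps_nth g j"
  shows "hcoef n (series_act G f w) = hcoef n (series_act G g w)"
  using assms by (simp add: series_act_def hcoef_hsum)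

context
  fixes G :: "'g \<Rightarrow> 'n::finite Hplus \<Rightarrow> 'n Hplus"
  assumes G: "\<And>g. Hlinear_on UNIV (G g)"
begin

lemma Hlinear_word_act: "Hlinear_on UNIV (word_act G gs)"
  using G by (induction gs) (simp_all add: Hlinear_on_def)

lemma Hlinear_monoid_act: "Hlinear_on UNIV (monoid_act G m)"
  using Hlinear_word_act by (cases m) (simp add: Hlinear_on_def)

lemma Hlinear_free_act: "Hlinear_on UNIV (free_act G p)"
proof (induction p rule: poly_mapping_single_induct)
  case (single m a)
  then show ?case
    using Hlinear_monoid_act[of m]
    by (simp add: Hlinear_on_def free_act_single Hmod.scale_right_distrib mult.commute)
next
  case (add p q)
  then show ?case
    by (simp add: Hlinear_on_def free_act_add Hmod.scale_right_distrib add_ac)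
qed

lemma monoid_act_add: "monoid_act G (m + m') w = monoid_act G m (monoid_act G m' w)"
proof -
  have "word_act G (gs @ gs') w = word_act G gs (word_act G gs' w)" for gs gs'
    by (induction gs) simp_all
  then show ?thesis by (cases m; cases m') simp
qed

lemma free_act_mult: "free_act G (p * q) w = free_act G p (free_act G q w)"
proof (induction p rule: poly_mapping_single_induct)
  case (single m a)
  show ?case
  proof (induction q rule: poly_mapping_single_induct)
    case (single m' b)
    show ?case
      using Hlinear_monoid_act[of m]
      by (simp add: mult_single free_act_single monoid_act_add Hlinear_on_def flip: fps_const_mult)
  next
    case (add q q')
    then show ?case
      using Hlinear_free_act[of "Poly_Mapping.single m a"]
      by (simp add: distrib_left free_act_add Hlinear_on_def)
  qed
qed (simp add: distrib_right free_act_add)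

lemma series_act_const_mult:
  "series_act G (fps_const p * g) w = free_act G p (series_act G g w)"
  using Hlinear_on_hsum[OF Hclosed_UNIV Hlinear_free_act, of "\<lambda>m. free_act G (fps_nth g m) w" p]
  by (simp add: series_act_def free_act_mult)

text \<open>Only \<open>f\<close> is split: f g = f_0 g + h f' g. The first term is handled by
  continuity of the action of f_0, and the second reproduces the defect with a factor h.\<close>

lemma series_act_mult: "series_act G (f * g) w = series_act G f (series_act G g w)"
proof -
  let ?d = "\<lambda>f. series_act G (f * g) w - series_act G f (series_act G g w)"
  have step: "?d f = Hplus_scale fps_X (?d (fps_shift 1 f))" for f
  proof -
    have "f * g = fps_const (fps_nth f 0) * g + fps_X * (fps_shift 1 f * g)"
      by (subst fps_split_X) (simp only: distrib_right mult.assoc)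
    then have "series_act G (f * g) w = free_act G (fps_nth f 0) (series_act G g w) +
        Hplus_scale fps_X (series_act G (fps_shift 1 f * g) w)"
      by (simp only: series_act_add series_act_const_mult series_act_X_mult)
    then show ?thesis
      by (subst series_act_split[of G f]) (simp add: Hmod.scale_right_diff_distrib)
  qed
  have "?d f = 0"
    by (rule h_divisible_imp_0[of UNIV ?d]) (use step in blast)+
  then show ?thesis by simp
qed

lemma Hlinear_series_act: "Hlinear_on UNIV (series_act G f)"
proof (rule Hlinear_onI[OF Hclosed_UNIV])
  note lin = Hlinear_free_act[unfolded Hlinear_on_def, simplified]
  show "series_act G f (v + w) = series_act G f v + series_act G f w" for v w
    by (simp add: series_act_def lin hsum_add)
  have scale: "series_act G f (Hplus_scale c w) = Hplus_scale c (series_act G f w)" for c w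
    using Hlinear_on_hsum[OF Hclosed_UNIV Hlinear_scale, of "\<lambda>m. free_act G (fps_nth f m) w" c]
    by (simp add: series_act_def lin)
  show "series_act G f (Hplus_scale (fps_const a) w) = Hplus_scale (fps_const a) (series_act G f w)"
    "series_act G f (Hplus_scale fps_X w) = Hplus_scale fps_X (series_act G f w)" for a w
    by (rule scale)+
qed

lemma series_act_closed:
  assumes W: "Hclosed W" and stable: "\<And>g w. w \<in> W \<Longrightarrow> G g w \<in> W" and w: "w \<in> W"
  shows "series_act G f w \<in> W"
proof -
  have word: "word_act G gs w \<in> W" for gs
    by (induction gs) (simp_all add: w stable)
  have "free_act G p w \<in> W" for p
  proof (induction p rule: poly_mapping_single_induct)
    case (single m a)
    show ?case
      using W word by (cases m) (simp add: free_act_single Hclosed_def)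
  qed (use W in \<open>simp add: free_act_add Hclosed_def\<close>)
  then show ?thesis
    using W by (simp add: series_act_def Hclosed_def)
qed

text \<open>The result in degree n depends only on the coefficients of \<open>f\<close> up to n, so
  annihilation survives h-adic limits; multiplicativity gives the ideal property. Thus checking the
  relators suffices for the action to descend.\<close>

lemma series_act_kernel: "closed_ideal {f. \<forall>w. series_act G f w = 0} = {f. \<forall>w. series_act G f w = 0}"
proof (intro antisym closed_ideal_superset closed_ideal_least order_refl)
  have "series_act G f 0 = 0" for f
    using Hlinear_on_0[OF Hlinear_series_act] by simp
  then show "two_sided_ideal {f. \<forall>w. series_act G f w = 0}"
    by (simp add: two_sided_ideal_def series_act_0 series_act_add series_act_mult)
  show "closed {f. \<forall>w. series_act G f w = 0}"
    unfolding closed_fps_iff mem_Collect_eq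
  proof (intro allI impI, rule Hplus_eqI)
    fix f w n
    assume "\<forall>n. \<exists>g\<in>{f. \<forall>w. series_act G f w = 0}. \<forall>j\<le>n. fps_nth g j = fps_nth f j"
    then obtain g where "\<forall>w. series_act G g w = 0" "\<forall>j\<le>n. fps_nth g j = fps_nth f j"
      by blast
    then show "hcoef n (series_act G f w) = hcoef n 0"
      using hcoef_series_act_cong[of n g f] by metis
  qed
qed

end

section \<open>Module structures determined by the generators\<close>

lemma abs_H_alg_rep: "abs_H_alg (rep_H_alg a) = a"
  by (rule Quotient3_abs_rep[OF Quotient3_H_alg])

lemma fps_const_word:
  "fps_const (Poly_Mapping.single (Word (g # gs)) a) =
     fps_const (free_gen g) * fps_const (Poly_Mapping.single (Word gs) a)"
  by (simp add: free_gen_def mult_single)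

lemma H_scalar_const: "H_scalar (fps_const a) = abs_H_alg (fps_const (Poly_Mapping.single (Word []) a))"
  unfolding H_scalar.abs_eq
  by (intro arg_cong[where f = abs_H_alg] fps_ext) (simp add: zero_free_monoid_def)

lemma H_scalar_X: "H_scalar fps_X = abs_H_alg fps_X"
  unfolding H_scalar.abs_eq by (intro arg_cong[where f = abs_H_alg] fps_ext) (simp add: fps_X_def)

text \<open>The module axioms fix the action on words and their combinations algebraically. They say
  nothing about infinite sums, and separatedness of the module supplies the step to power series in
  h.\<close>

lemma H_module_eq_series_act:
  fixes act :: "'n::finite H_alg \<Rightarrow> 'n Hplus \<Rightarrow> 'n Hplus"
  assumes W: "Hclosed W" and act: "H_module Hplus_scale W act"
    and G: "\<And>g. Hlinear_on UNIV (G g)"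
    and gen: "\<And>g w. w \<in> W \<Longrightarrow> act (abs_H_alg (fps_const (free_gen g))) w = G g w"
    and w: "w \<in> W"
  shows "act (abs_H_alg f) w = series_act G f w"
proof -
  have act_add: "act (abs_H_alg (f + g)) w = act (abs_H_alg f) w + act (abs_H_alg g) w"
    and act_mult: "act (abs_H_alg (f * g)) w = act (abs_H_alg f) (act (abs_H_alg g) w)"
    and act_scalar: "act (H_scalar u) w = Hplus_scale u w"
    and act_W: "act a w \<in> W" if "w \<in> W" for f g u a w
    using act that by (auto simp: H_module_def simp flip: plus_H_alg.abs_eq times_H_alg.abs_eq)
  \<comment> \<open>Membership in \<open>W\<close> is carried through the induction because
    \<open>gen\<close> applies only to elements of \<open>W\<close>.\<close>
  have word: "act (abs_H_alg (fps_const (Poly_Mapping.single (Word gs) a))) w =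
      Hplus_scale (fps_const a) (word_act G gs w) \<and> word_act G gs w \<in> W" for gs a
  proof (induction gs)
    case Nil
    show ?case
      using act_scalar[OF w, of "fps_const a"] w by (simp add: H_scalar_const)
  next
    case (Cons g gs)
    have scaled: "Hplus_scale (fps_const a) (word_act G gs w) \<in> W"
      using Cons W by (simp add: Hclosed_def)
    have "G g (word_act G gs w) \<in> W"
      using gen[of "word_act G gs w" g] act_W Cons by metis
    then show ?case
      unfolding fps_const_word act_mult[OF w]
      using Cons scaled G[of g] by (simp add: gen Hlinear_on_def)
  qed
  have const: "act (abs_H_alg (fps_const p)) w = free_act G p w" for p
  proof (induction p rule: poly_mapping_single_induct)
    case (single m a)
    then show ?case
      using word by (cases m) (simp add: free_act_single)
  next
    case (add p q)
    then show ?case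
      using act_add[OF w, of "fps_const p" "fps_const q"] by (simp add: free_act_add)
  qed
  let ?d = "\<lambda>f. act (abs_H_alg f) w - series_act G f w"
  have step: "?d f = Hplus_scale fps_X (?d (fps_shift 1 f))" for f
  proof -
    have "act (abs_H_alg f) w =
        free_act G (fps_nth f 0) w + Hplus_scale fps_X (act (abs_H_alg (fps_shift 1 f)) w)"
      by (subst fps_split_X, subst act_add[OF w], subst act_mult[OF w])
        (simp add: const act_scalar act_W w flip: H_scalar_X)
    then show ?thesis
      by (subst series_act_split) (simp add: Hmod.scale_right_diff_distrib)
  qed
  have "?d f = 0"
    by (rule h_divisible_imp_0[of UNIV ?d]) (use step in blast)+
  then show ?thesis by simp
qed

section \<open>The action of the generators at level c\<close>

definition gen_act ::
  "complex \<Rightarrow> 'n::finite cartan fps \<Rightarrow> 'n H_gen \<Rightarrow> 'n Hplus \<Rightarrow> 'n Hplus" where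
  "gen_act c \<alpha> g =
     (case g of Gen_C \<Rightarrow> Hplus_scale (fps_const c) | Gen_y i r \<Rightarrow> y_coeff c \<alpha> i (- r - 1))"

lemma gen_act_simps:
  "gen_act c \<alpha> Gen_C = Hplus_scale (fps_const c)"
  "gen_act c \<alpha> (Gen_y i r) = y_coeff c \<alpha> i (- r - 1)"
  by (simp_all add: gen_act_def)

lemma Hlinear_gen_act: "Hlinear_on UNIV (gen_act c \<alpha> g)"
  by (simp add: gen_act_def Hlinear_scale Hlinear_y_coeff split: H_gen.split)

lemmas free_act_gen_act_mult =
  free_act_mult[where G = "gen_act c \<alpha>", OF Hlinear_gen_act] for c \<alpha>

lemmas series_act_gen_act_mult =
  series_act_mult[where G = "gen_act c \<alpha>", OF Hlinear_gen_act] for c \<alpha>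

lemmas series_act_gen_act_kernel =
  series_act_kernel[where G = "gen_act c \<alpha>", OF Hlinear_gen_act] for c \<alpha>

lemmas Hlinear_series_act_gen_act =
  Hlinear_series_act[where G = "gen_act c \<alpha>", OF Hlinear_gen_act] for c \<alpha>

lemma gen_act_V_H: "w \<in> V_H \<Longrightarrow> gen_act c \<alpha> g w \<in> V_H"
  by (cases g) (simp_all add: gen_act_simps V_H_eq V_over_scale y_coeff_V_over)

text \<open>The generator C acts by the scalar c, so a polynomial in C acts by its value at c; in
  this way s_ij(u, C) in the relators becomes s_ij(u).\<close>

lemma series_at_C_act:
  "series_act (gen_act c \<alpha>) (series_at_C f) w =
     Hplus_scale (Abs_fps (\<lambda>m. poly (fps_nth f m) c)) w"
proof -
  have pow: "free_act (gen_act c \<alpha>) (free_gen Gen_C ^ k) w = Hplus_scale (fps_const (c ^ k)) w" for k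
  proof (induction k)
    case 0
    show ?case using free_act_scalar[of "gen_act c \<alpha>" 1 w] by simp
  next
    case (Suc k)
    then show ?case
      by (simp add: free_act_gen_act_mult free_act_free_gen gen_act_simps)
  qed
  have "free_act (gen_act c \<alpha>) (poly_at_C p) w = Hplus_scale (fps_const (poly p c)) w" for p
  proof -
    have "fps_const (poly p c) = (\<Sum>k\<le>Polynomial.degree p. fps_const (coeff p k * c ^ k))"
      unfolding poly_altdef by (rule fps_ext) (simp add: fps_sum_nth)
    then show ?thesis
      by (simp add: poly_at_C_def free_act_sum free_act_gen_act_mult free_act_scalar pow
          Hmod.scale_sum_left)
  qed
  then show ?thesis
    using hsum_scale[of "Abs_fps (\<lambda>m. poly (fps_nth f m) c)" w]
    by (simp add: series_act_def series_at_C_def)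
qed

lemma series_act_relators:
  assumes "f \<in> H_relators"
  shows "series_act (gen_act c \<alpha>) f w = 0"
proof -
  let ?act = "series_act (gen_act c \<alpha>)"
  have C: "?act free_C w = Hplus_scale (fps_const c) w" for w
    by (simp add: free_C_def series_act_const free_act_free_gen gen_act_simps)
  have y: "?act (free_y i r) w = y_coeff c \<alpha> i (- r - 1) w" for i r w
    by (simp add: free_y_def series_act_const free_act_free_gen gen_act_simps)
  have mult: "?act (f * g) w = ?act f (?act g w)" for f g w
    by (rule series_act_gen_act_mult)
  have diff: "?act (f - g) w = ?act f w - ?act g w" for f g w
    using series_act_add[of "gen_act c \<alpha>" "f - g" g w] by simp
  have sum: "?act (sum f I) w = (\<Sum>i\<in>I. ?act (f i) w)" for f and I :: "'a set" and w
    by (induction I rule: infinite_finite_induct) (simp_all add: series_act_add series_act_0)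
  \<comment> \<open>Centrality of C is linearity of the operators over scalars, the trace relators
    are \<open>sum_y_coeff\<close>, and the third family is \<open>y_coeff_commute\<close>.\<close>
  show ?thesis
    using assms Hlinear_y_coeff[of c \<alpha>]
    by (auto simp: H_relators_def diff mult sum C y sum_y_coeff series_act_add series_at_C_act
        poly_s_C_exp Hlinear_on_def intro!: y_coeff_commute)
qed

lemma series_act_closed_ideal:
  assumes "f \<in> closed_ideal H_relators"
  shows "series_act (gen_act c \<alpha>) f w = 0"
proof -
  have "closed_ideal H_relators \<subseteq> closed_ideal {f. \<forall>w. series_act (gen_act c \<alpha>) f w = 0}"
    unfolding closed_ideal_def using series_act_relators by blast
  then show ?thesis
    using assms series_act_gen_act_kernel by blast
qed

text \<open>Restriction makes the value \<open>undefined\<close> outside \<open>V_H\<close>, as the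
  extensional function space in \<open>H_module\<close> demands; uniqueness can then be plain
  equality of functions.\<close>

definition H_op :: "complex \<Rightarrow> 'n::finite cartan fps \<Rightarrow> 'n H_alg \<Rightarrow> 'n Hplus \<Rightarrow> 'n Hplus" where
  "H_op c \<alpha> a = restrict (series_act (gen_act c \<alpha>) (rep_H_alg a)) V_H"

lemma H_op_abs:
  assumes "w \<in> V_H"
  shows "H_op c \<alpha> (abs_H_alg f) w = series_act (gen_act c \<alpha>) f w"
proof -
  have "rep_H_alg (abs_H_alg f) - f \<in> closed_ideal H_relators"
    using abs_H_alg_rep[of "abs_H_alg f"] H_alg.abs_eq_iff by blast
  then have "series_act (gen_act c \<alpha>) (rep_H_alg (abs_H_alg f) - f + f) w =
      series_act (gen_act c \<alpha>) f w"
    by (simp only: series_act_add series_act_closed_ideal) simp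
  with assms show ?thesis by (simp add: H_op_def)
qed

lemma H_op_gen: "w \<in> V_H \<Longrightarrow> H_op c \<alpha> (abs_H_alg (fps_const (free_gen g))) w = gen_act c \<alpha> g w"
  by (simp add: H_op_abs series_act_const free_act_free_gen)

lemma H_C_eq: "H_C = abs_H_alg (fps_const (free_gen Gen_C))"
  by (simp add: H_C.abs_eq free_C_def)

lemma H_y_eq: "H_y i r = abs_H_alg (fps_const (free_gen (Gen_y i r)))"
  by (simp add: H_y.abs_eq free_y_def)

lemma H_module_H_op: "H_module Hplus_scale V_H (H_op c \<alpha>)"
proof -
  have V: "Hclosed V_H" by (simp add: V_H_eq Hclosed_V_over)
  have W: "series_act (gen_act c \<alpha>) f w \<in> V_H" if "w \<in> V_H" for f w
    by (rule series_act_closed[where G = "gen_act c \<alpha>", OF Hlinear_gen_act V gen_act_V_H that])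
  have "H_op c \<alpha> a \<in> V_H \<rightarrow>\<^sub>E V_H" for a
    unfolding H_op_def by (intro restrict_PiE_iff[THEN iffD2] ballI W)
  moreover have "H_op c \<alpha> a (v + w) = H_op c \<alpha> a v + H_op c \<alpha> a w"
    if "v \<in> V_H" "w \<in> V_H" for a v w
    using that Hlinear_series_act_gen_act[of c \<alpha> "rep_H_alg a"]
    by (simp add: H_op_def Hlinear_on_def V_H_eq V_over_add)
  moreover have "H_op c \<alpha> (a + b) w = H_op c \<alpha> a w + H_op c \<alpha> b w" if "w \<in> V_H" for a b w
  proof -
    have "a + b = abs_H_alg (rep_H_alg a + rep_H_alg b)"
      by (simp add: abs_H_alg_rep flip: plus_H_alg.abs_eq)
    then show ?thesis
      using that by (simp only: H_op_abs series_act_add) (simp add: H_op_def)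
  qed
  moreover have "H_op c \<alpha> (a * b) w = H_op c \<alpha> a (H_op c \<alpha> b w)" if "w \<in> V_H" for a b w
  proof -
    have "a * b = abs_H_alg (rep_H_alg a * rep_H_alg b)"
      by (simp add: abs_H_alg_rep flip: times_H_alg.abs_eq)
    then show ?thesis
      using that W by (simp only: H_op_abs series_act_gen_act_mult) (simp add: H_op_def)
  qed
  moreover have "H_op c \<alpha> 1 w = w" if "w \<in> V_H" for w
  proof -
    have "H_op c \<alpha> (abs_H_alg (fps_const (Poly_Mapping.single 0 1))) w = w"
      using that by (simp only: H_op_abs series_act_const free_act_scalar) simp
    then show ?thesis
      by (simp add: one_H_alg.abs_eq)
  qed
  moreover have "H_op c \<alpha> (H_scalar f) w = Hplus_scale f w" if "w \<in> V_H" for f w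
    using that unfolding H_scalar.abs_eq by (simp add: H_op_abs series_act_scalar)
  ultimately show ?thesis
    unfolding H_module_def by (simp add: module_Hplus Hclosed_subspace[OF V])
qed

section \<open>The diagonal identity and the theorem\<close>

lemma x_plus_tensor_diag_V_H:
  assumes "\<forall>p\<in>set ps. fst p = snd p"
  shows "x_plus_tensor n ps ks \<in> V_H"
proof -
  have "prod_list (map (\<lambda>z. x_plus (fst (fst z)) (snd (fst z)) (snd z)) zs) \<in> V_over diag_vars"
    if "\<forall>z\<in>set zs. fst (fst z) = snd (fst z)" for zs :: "(('a \<times> 'a) \<times> int) list"
    using that
  proof (induction zs)
    case (Cons z zs)
    have "x_plus (fst (fst z)) (snd (fst z)) (snd z) \<in> V_over diag_vars"
      using Cons.prems Hplus_x_V_over[OF diag_complete_diag_vars, of "snd (fst z)" "snd (fst z)"]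
      by (simp add: x_plus_def V_over_0 diag_vars_def)
    with Cons show ?case by (simp add: mult_V_over)
  qed (simp add: one_V_over)
  moreover have "\<forall>z\<in>set (zip ps ks). fst (fst z) = snd (fst z)"
    using assms by (fastforce dest: set_zip_leftD)
  ultimately show ?thesis
    by (simp add: x_plus_tensor_eq V_H_eq V_over_0)
qed

lemma y_op_tensor:
  fixes act :: "'n::finite H_alg \<Rightarrow> 'n Hplus \<Rightarrow> 'n Hplus"
  assumes "\<And>i k w. w \<in> V_H \<Longrightarrow> y_series act i w k = y_coeff c \<alpha> i k w"
  shows "apply_0 (y_op act) (diag (x_plus_tensor n)) = diag (apply_0 (x_a_op c \<alpha>) (x_plus_tensor n))"
proof (intro ext)
  fix ps :: "('n \<times> 'n) list" and ks
  show "apply_0 (y_op act) (diag (x_plus_tensor n)) ps ks =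
      diag (apply_0 (x_a_op c \<alpha>) (x_plus_tensor n)) ps ks"
  proof (cases "(x_a_op c \<alpha>, x_plus_tensor n :: ('n, 'n Hplus) tensor_series, ps, ks)"
      rule: apply_0.cases)
    case (1 A T i j ps' k ks')
    \<comment> \<open>On the left \<open>diag\<close> comes before the operator, so for a
      non-diagonal tail the operator is applied to 0 and has to return 0.\<close>
    have 0: "y_op act i j 0 k = 0"
      using assms[of 0 i k] Hlinear_on_0[OF Hlinear_y_coeff, of c \<alpha> i k]
      by (cases "i = j") (simp_all add: y_op_def V_H_eq V_over_0)
    have "y_op act i i (x_plus_tensor n ps' ks') k = x_a_op c \<alpha> i i (x_plus_tensor n ps' ks') k"
      if "\<forall>p\<in>set ps'. fst p = snd p"
      using assms[OF x_plus_tensor_diag_V_H[OF that, of n ks'], of i k] by (simp add: y_op_def y_coeff_def)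
    then show ?thesis
      using 1 0 by (auto simp: diag_def y_op_def)
  qed (auto simp: diag_def)
qed

text \<open>Reading the tensor identity at the matrix unit (i, i) in front of a diagonal tail gives
  the values on products of diagonal generators, which determine a linear map on
  \<open>V_H\<close>.\<close>

lemma y_series_eq_y_coeff:
  fixes act :: "'n::finite H_alg \<Rightarrow> 'n Hplus \<Rightarrow> 'n Hplus"
  assumes hom: "y_series act i \<in> series_Hom Hplus_scale V_H F"
    and tensor: "\<forall>n. apply_0 (y_op act) (diag (x_plus_tensor n)) =
      diag (apply_0 (x_a_op c \<alpha>) (x_plus_tensor n))"
    and w: "w \<in> V_H"
  shows "y_series act i w k = y_coeff c \<alpha> i k w"
proof (rule Hlinear_on_eqI[OF diag_complete_diag_vars, where T = "\<lambda>w. y_series act i w k"])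
  show "Hlinear_on (V_over diag_vars) (\<lambda>w. y_series act i w k)"
    using hom by (simp add: series_Hom_def Hlinear_on_def V_H_eq)
  show "Hlinear_on (V_over diag_vars) (y_coeff c \<alpha> i k)"
    using Hlinear_y_coeff by (rule Hlinear_on_subset) simp
  show "w \<in> V_over diag_vars"
    using w by (simp add: V_H_eq)
  fix vs :: "('n \<times> 'n \<times> nat) list"
  assume vs: "set vs \<subseteq> diag_vars"
  let ?n = "length vs"
  let ?ps = "map (\<lambda>(i, j, k). (i, j)) vs" and ?ks = "map (\<lambda>(i, j, k). int k) vs"
  have "\<forall>p\<in>set ?ps. fst p = snd p"
    using vs by (auto simp: diag_vars_def)
  then have "y_series act i (x_plus_tensor ?n ?ps ?ks) k = x_a_op c \<alpha> i i (x_plus_tensor ?n ?ps ?ks) k"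
    using fun_cong[OF fun_cong[OF tensor[rule_format, of ?n]], of "(i, i) # ?ps" "k # ?ks"]
    by (simp add: diag_def y_op_def)
  then show "y_series act i (xprod vs) k = y_coeff c \<alpha> i k (xprod vs)"
    by (simp add: xprod_eq_x_plus_tensor y_coeff_def)
qed

lemma topologically_free_V_H: "topologically_free Hplus_scale V_H"
  by (simp add: V_H_eq topologically_free_V_over diag_complete_diag_vars)

theorem proposition3p1:
  fixes c :: complex and \<alpha> :: "'n::finite cartan fps"
  assumes "CARD('n) \<ge> 2"
  shows "\<exists>!act :: 'n H_alg \<Rightarrow> 'n Hplus \<Rightarrow> 'n Hplus.
           H_module Hplus_scale V_H act \<and>
           H_restricted Hplus_scale V_H act \<and>
           H_level Hplus_scale V_H act c \<and>
           (\<forall>n. apply_0 (y_op act) (diag (x_plus_tensor n)) =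
                diag (apply_0 (x_a_op c \<alpha>) (x_plus_tensor n)))"
proof (rule ex1I[of _ "H_op c \<alpha>"])
  have y: "y_series (H_op c \<alpha>) i w k = y_coeff c \<alpha> i k w" if "w \<in> V_H" for i w k
    using that by (simp add: y_series_def H_y_eq H_op_gen gen_act_simps)
  have "y_series (H_op c \<alpha>) i \<in> series_Hom Hplus_scale V_H (laurent_h Hplus_scale V_H)" for i
  proof -
    have "y_series (H_op c \<alpha>) i w = (\<lambda>k. y_coeff c \<alpha> i k w)" if "w \<in> V_H" for w
      using y[OF that] by auto
    then show ?thesis
      using Hlinear_y_coeff[of c \<alpha> i] y_coeff_laurent[of _ c \<alpha> i]
      by (simp add: series_Hom_def Hlinear_on_def V_H_eq V_over_add V_over_scale)
  qed
  moreover have "H_level Hplus_scale V_H (H_op c \<alpha>) c"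
    by (simp add: H_level_def H_C_eq H_op_gen gen_act_simps)
  ultimately show "H_module Hplus_scale V_H (H_op c \<alpha>) \<and> H_restricted Hplus_scale V_H (H_op c \<alpha>) \<and>
      H_level Hplus_scale V_H (H_op c \<alpha>) c \<and>
      (\<forall>n. apply_0 (y_op (H_op c \<alpha>)) (diag (x_plus_tensor n)) =
        diag (apply_0 (x_a_op c \<alpha>) (x_plus_tensor n)))"
    by (simp add: H_module_H_op H_restricted_def topologically_free_V_H y_op_tensor[OF y])
next
  fix act :: "'n H_alg \<Rightarrow> 'n Hplus \<Rightarrow> 'n Hplus"
  assume act: "H_module Hplus_scale V_H act \<and> H_restricted Hplus_scale V_H act \<and>
      H_level Hplus_scale V_H act c \<and>
      (\<forall>n. apply_0 (y_op act) (diag (x_plus_tensor n)) =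
        diag (apply_0 (x_a_op c \<alpha>) (x_plus_tensor n)))"
  then have mod: "H_module Hplus_scale V_H act" by blast
  have y: "y_series act i w k = y_coeff c \<alpha> i k w" if "w \<in> V_H" for i w k
    using act that unfolding H_restricted_def by (blast intro: y_series_eq_y_coeff)
  \<comment> \<open>The level fixes the action of C, and the diagonal identity fixes that of the y
    generators.\<close>
  have gen: "act (abs_H_alg (fps_const (free_gen g))) w = gen_act c \<alpha> g w" if "w \<in> V_H" for g w
  proof (cases g)
    case Gen_C
    then show ?thesis
      using act that by (simp add: H_level_def gen_act_simps flip: H_C_eq)
  next
    case (Gen_y i r)
    then show ?thesis
      using y[OF that, of i "- r - 1"] by (simp add: y_series_def gen_act_simps flip: H_y_eq)
  qed
  show "act = H_op c \<alpha>"
  proof (intro ext)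
    fix a w
    show "act a w = H_op c \<alpha> a w"
    proof (cases "w \<in> V_H")
      case True
      have "Hclosed V_H" by (simp add: V_H_eq Hclosed_V_over)
      from H_module_eq_series_act[where G = "gen_act c \<alpha>", OF this mod Hlinear_gen_act gen True, of "rep_H_alg a"]
      show ?thesis using True by (simp add: abs_H_alg_rep H_op_def)
    next
      case False
      have "act a \<in> V_H \<rightarrow>\<^sub>E V_H"
        using mod unfolding H_module_def by (elim conjE) (rule spec)
      then show ?thesis
        using PiE_arb[OF _ False] False by (simp add: H_op_def)
    qed
  qed
qed

end
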